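(* Let $p>1$ and suppose the standing assumptions (1)-(6) of the context hold. Assume that $n\varepsilon_n^p\to0$ as $n\to\infty$ (which, due to (5), implies $p>d$). Let $f_n:\Omega_n\to\mathbb{R}$ and assume furthermore that, with probability one, $(\mu_n,f_n)\to(\mu,f)$ in the $TL^p$ metric as $n\to\infty$ and $\sup_{n\in\mathbb{N}}\mathcal{E}_n^{(p)}(f_n)<\infty$. Then $f\in C^{0,\gamma}(\Omega)$ with $\gamma=1-\frac dp>0$, and for all $\Omega'\subset\subset\Omega$ $$\max_{\{k\le n\,:\,x_k\in\Omega'\}}|f(x_k)-f_n(x_k)|\to0\qquad\text{as }n\to\infty.$$ Moreover, if for all $k=1,\dots,N$ one has $f_n(x_k)=y_k$ for all $n$, then $f(x_k)=y_k$ for all $k=1,\dots,N$.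
   Context: Standing assumptions. (1) $\Omega\subset\mathbb{R}^d$ ($d\ge1$) is open, connected, bounded, with Lipschitz boundary. (2) $\mu$ is a probability measure on $\Omega$ with a continuous density $\rho$ (with respect to Lebesgue measure) that is bounded above and below by strictly positive constants in $\Omega$. (3) $N\ge1$ is fixed and $(x_i,y_i)\in\Omega\times\mathbb{R}$, $i=1,\dots,N$, are labeled points, with the $x_i$ distinct. (4) For $i>N$ the points $x_i$ are iid samples of $\mu$; "with probability one" refers to this sample, and the conclusions are understood with probability one. (5) $\varepsilon_n>0$, $\varepsilon_n\to0$, and $\varepsilon_n/\ell_n\to\infty$, where $\ell_n=\sqrt{\log\log n/n}$ if $d=1$, $\ell_n=(\log n)^{3/4}/\sqrt{n}$ if $d=2$, $\ell_n=(\log n/n)^{1/d}$ if $d\ge3$. (6) $\eta:[0,\infty)\to[0,\infty)$ is non-increasing, is positive and continuous at $0$, and $\sigma_\eta:=\int_{\mathbb{R}^d}\eta(|w|)\,|w\cdot e_1|^p\,dw<\infty$, where $e_1=(1,0,\dots,0)$. Notation. $\Omega_n=\{x_1,\dots,x_n\}$, $\mu_n=\frac1n\sum_{i=1}^n\delta_{x_i}$, $\eta_\varepsilon(t)=\varepsilon^{-d}\eta(t/\varepsilon)$, $W_{ij}=\eta_{\varepsilon_n}(|x_i-x_j|)$, and for $f:\Omega_n\to\mathbb{R}$, $$\mathcal{E}_n^{(p)}(f)=\frac{1}{\varepsilon_n^p n^2}\sum_{i,j=1}^nW_{ij}|f(x_i)-f(x_j)|^p.$$ The limit $f\in L^p(\mu)$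 is identified with its continuous representative. $TL^p$ space. $TL^p(\Omega)=\{(\nu,g):\nu\in\mathcal{P}(\overline\Omega),\ g\in L^p(\nu)\}$ with metric $$d_{TL^p}^p((\nu_1,g_1),(\nu_2,g_2))=\inf_{\pi\in\Pi(\nu_1,\nu_2)}\int|x-y|^p+|g_1(x)-g_2(y)|^p\,d\pi(x,y),$$ $\Pi(\nu_1,\nu_2)$ being the set of couplings. *)

theory Defs
  imports "HOL-Probability.Probability"
begin

text \<open>
  The boundary is locally, in suitable orthonormal coordinates, the graph of a Lipschitz function
  with the set on one side of it. The unit vector v is the graph direction; the hyperplane
  orthogonal to v plays the role of the space of the remaining coordinates.
\<close>
definition lipschitz_boundary :: "'a::euclidean_space set \<Rightarrow> bool" where
  "lipschitz_boundary \<Omega> \<longleftrightarrow>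
     (\<forall>z\<in>frontier \<Omega>. \<exists>r>0. \<exists>v L g. norm v = 1 \<and> L-lipschitz_on {h. h \<bullet> v = 0} g \<and>
        \<Omega> \<inter> ball z r = {x \<in> ball z r. x \<bullet> v > (g (x - (x \<bullet> v) *\<^sub>R v) :: real)})"

definition compactly_contained :: "'a::topological_space set \<Rightarrow> 'a set \<Rightarrow> bool" where
  "compactly_contained S \<Omega> \<longleftrightarrow> compact (closure S) \<and> closure S \<subseteq> \<Omega>"

text \<open>The space of functions with finite (global) Hoelder norm, for exponent \<gamma>.\<close>
definition holder_space :: "real \<Rightarrow> 'a::metric_space set \<Rightarrow> ('a \<Rightarrow> real) set" where
  "holder_space \<gamma> S =
     {f. bounded (f ` S) \<and> (\<exists>C. \<forall>x\<in>S. \<forall>y\<in>S. \<bar>f x - f y\<bar> \<le> C * dist x y powr \<gamma>)}"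

text \<open>The lower bound on the admissible connectivity radius in dimension d.\<close>
definition length_scale :: "nat \<Rightarrow> nat \<Rightarrow> real" where
  "length_scale d n =
     (if d = 1 then sqrt (ln (ln (real n)) / real n)
      else if d = 2 then ln (real n) powr (3/4) / sqrt (real n)
      else (ln (real n) / real n) powr (1 / real d))"

definition sigma_eta :: "'a::euclidean_space \<Rightarrow> real \<Rightarrow> (real \<Rightarrow> real) \<Rightarrow> ennreal" where
  "sigma_eta e\<^sub>1 p \<eta> = (\<integral>\<^sup>+ w. ennreal (\<eta> (norm w) * \<bar>w \<bullet> e\<^sub>1\<bar> powr p) \<partial>lborel)"

text \<open>Point sequences are indexed from 1.\<close>
definition sample_points :: "(nat \<Rightarrow> 'a) \<Rightarrow> nat \<Rightarrow> 'a set" where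
  "sample_points x n = x ` {1..n}"

definition empirical_measure :: "(nat \<Rightarrow> 'a::euclidean_space) \<Rightarrow> nat \<Rightarrow> 'a measure" where
  "empirical_measure x n = distr (uniform_count_measure {1..n}) borel x"

definition rescaled_kernel :: "nat \<Rightarrow> (real \<Rightarrow> real) \<Rightarrow> real \<Rightarrow> real \<Rightarrow> real" where
  "rescaled_kernel d \<eta> \<epsilon> t = \<eta> (t / \<epsilon>) / \<epsilon> ^ d"

definition graph_energy ::
  "real \<Rightarrow> (real \<Rightarrow> real) \<Rightarrow> (nat \<Rightarrow> real) \<Rightarrow> (nat \<Rightarrow> 'a::euclidean_space) \<Rightarrow> nat \<Rightarrow> ('a \<Rightarrow> real) \<Rightarrow> real" where
  "graph_energy p \<eta> \<epsilon> x n f =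
     1 / (\<epsilon> n powr p * (real n)\<^sup>2) *
     (\<Sum>i=1..n. \<Sum>j=1..n.
        rescaled_kernel DIM('a) \<eta> (\<epsilon> n) (norm (x i - x j)) * \<bar>f (x i) - f (x j)\<bar> powr p)"

text \<open>
  Measures on the closure of \<Omega> are represented as Borel measures on the whole space that are
  concentrated there, and elements of Lp by Borel representatives.
\<close>
definition TLp :: "real \<Rightarrow> 'a::euclidean_space set \<Rightarrow> ('a measure \<times> ('a \<Rightarrow> real)) set" where
  "TLp p \<Omega> =
     {(\<nu>, g). sets \<nu> = sets borel \<and> prob_space \<nu> \<and> emeasure \<nu> (closure \<Omega>) = 1 \<and>
              g \<in> borel_measurable \<nu> \<and> integrable \<nu> (\<lambda>x. \<bar>g x\<bar> powr p)}"

definition couplings :: "'a::euclidean_space measure \<Rightarrow> 'a measure \<Rightarrow> ('a \<times> 'a) measure set" where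
  "couplings \<nu>\<^sub>1 \<nu>\<^sub>2 = {\<pi>. sets \<pi> = sets borel \<and> distr \<pi> borel fst = \<nu>\<^sub>1 \<and> distr \<pi> borel snd = \<nu>\<^sub>2}"

text \<open>The p-th power of the distance; it is finite whenever both arguments are in TLp.\<close>
definition tlp_cost ::
  "real \<Rightarrow> 'a::euclidean_space measure \<times> ('a \<Rightarrow> real) \<Rightarrow> 'a measure \<times> ('a \<Rightarrow> real) \<Rightarrow> ennreal" where
  "tlp_cost p A B =
     (INF \<pi>\<in>couplings (fst A) (fst B).
        \<integral>\<^sup>+ z. ennreal (norm (fst z - snd z) powr p + \<bar>snd A (fst z) - snd B (snd z)\<bar> powr p) \<partial>\<pi>)"

definition tlp_dist ::
  "real \<Rightarrow> 'a::euclidean_space measure \<times> ('a \<Rightarrow> real) \<Rightarrow> 'a measure \<times> ('a \<Rightarrow> real) \<Rightarrow> ennreal" where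
  "tlp_dist p A B =
     (if tlp_cost p A B = \<top> then \<top> else ennreal (enn2real (tlp_cost p A B) powr (1 / p)))"

definition tlp_converges ::
  "real \<Rightarrow> 'a::euclidean_space set \<Rightarrow> (nat \<Rightarrow> 'a measure \<times> ('a \<Rightarrow> real)) \<Rightarrow>
     'a measure \<times> ('a \<Rightarrow> real) \<Rightarrow> bool" where
  "tlp_converges p \<Omega> S A \<longleftrightarrow>
     A \<in> TLp p \<Omega> \<and> (\<forall>\<^sub>F n in sequentially. S n \<in> TLp p \<Omega>) \<and> (\<lambda>n. tlp_dist p (S n) A) \<longlonglongrightarrow> 0"

text \<open>
  A function on the sample points is given by a function on the whole space whose values elsewhere
  are irrelevant. Extending by zero makes it Borel measurable without changing its class
  modulo the empirical measure.
\<close>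
definition extend_by_zero :: "'a set \<Rightarrow> ('a \<Rightarrow> real) \<Rightarrow> 'a \<Rightarrow> real" where
  "extend_by_zero S f x = (if x \<in> S then f x else 0)"

text \<open>The maximal deviation over the sample points in S, with value 0 if there are none.\<close>
definition max_deviation ::
  "(nat \<Rightarrow> 'a) \<Rightarrow> nat \<Rightarrow> 'a set \<Rightarrow> ('a \<Rightarrow> real) \<Rightarrow> ('a \<Rightarrow> real) \<Rightarrow> real" where
  "max_deviation x n S f g = Max (insert 0 ((\<lambda>k. \<bar>f (x k) - g (x k)\<bar>) ` {k\<in>{1..n}. x k \<in> S}))"

end

theory Submission
  imports Defs "HOL-Real_Asymp.Real_Asymp"
begin

text \<open>
  Almost surely, for large $n$ every
  ball of radius $h = s\varepsilon_n$ inside $\Omega$ contains at least $c\,n\varepsilon_n^d$ sample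
  points: this follows from a Chernoff bound on a net of centres and Borel-Cantelli, because
  $n\varepsilon_n^d / \log n \to \infty$ in every dimension. Let $F_n(u)$ be the mean of $f_n$ over the
  sample points in the $h$-ball at $u$. The energy bound gives
  $\int |F_n(u+w) - F_n(u)|^p\,du \le C\varepsilon_n^p$ for $|w| \le h$, hence, by chaining steps of
  length $h$, a Poincare inequality on all balls of radius $R \ge h$, and, by telescoping over
  dyadic radii as in Morrey's theorem, $|F_n(u) - F_n(v)| \le C R^\gamma$ for $|u-v| \le R$ and
  $R \ge h$. The energy terms at a single point bound $|f_n(x_i) - F_n(x_i)|^p \le C n\varepsilon_n^p \to 0$,
  so $f_n$ is asymptotically Hoelder in the interior. Couplings of small cost match, in every ball,
  some sample value of $f_n$ with a typical value of $f$; this transfers the oscillation bound to $f$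
  and yields uniform convergence on compactly contained sets. Finally the interior oscillation
  bound extends up to the Lipschitz boundary by walking along the interior cone.
\<close>

subsection \<open>A Morrey estimate for discrete functions\<close>

text \<open>The energy sees differences only at distances of order \<epsilon>, so it is averaged in
  Lebesgue measure over the centre \<open>u\<close>: an edge then counts only for \<open>u\<close>
  in a ball of volume about h^d, and the factor h^(p-d) becomes h^p. Since counts only appear in
  denominators, lower bounds on them suffice. The normalisation \<kappa> h^(p-d) m^2 in
  \<open>point_cloud\<close>, with m of order n \<epsilon>^d, keeps \<kappa> independent of n. For a
  single point it leaves \<kappa> h^(p-d) m, of order n \<epsilon>^p, which is where the hypothesis
  on n \<epsilon>^p acts. The edge range 3h is h + h + h: two points within h of two centres at
  distance at most h. The obstacle in the limit is that f is only a class modulo null sets, so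
  couplings give no pointwise values. Comparisons are made on sets of positive measure, and the
  required n depends on such a set only through a lower bound on its measure; this uniformity gives
  access to a maximum over growing sets of sample points. The oscillation bounds ask for a dilated
  ball inside \<Omega>, hence the separate treatment of the boundary.\<close>

lemma abs_sum_powr_le:
  fixes t :: "'b \<Rightarrow> real"
  assumes fin: "finite A" and p: "p \<ge> 1"
  shows "\<bar>\<Sum>a\<in>A. t a\<bar> powr p \<le> real (card A) powr (p - 1) * (\<Sum>a\<in>A. \<bar>t a\<bar> powr p)"
proof -
  \<comment> \<open>Only the nonzero terms are kept, so that convexity of \<open>powr\<close> is
    applied to positive values.\<close>
  define B where "B = {a\<in>A. t a \<noteq> 0}"
  have B: "B \<subseteq> A" "finite B" using fin by (auto simp: B_def)
  have s1: "(\<Sum>a\<in>A. t a) = (\<Sum>a\<in>B. t a)"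
    by (rule sum.mono_neutral_right) (use fin in \<open>auto simp: B_def\<close>)
  show ?thesis
  proof (cases "B = {}")
    case True
    then show ?thesis using s1 p by (simp add: sum_nonneg)
  next
    case False
    define c where "c = real (card B)"
    have c: "c > 0" using False B by (simp add: c_def card_gt_0_iff)
    have "(\<Sum>a\<in>B. (1/c) *\<^sub>R \<bar>t a\<bar>) powr p \<le> (\<Sum>a\<in>B. (1/c) * (\<bar>t a\<bar> powr p))"
      by (rule convex_on_sum[OF B(2) False powr_convex[OF p]])
         (use c in \<open>auto simp: c_def B_def\<close>)
    then have 1: "((\<Sum>a\<in>B. \<bar>t a\<bar>) / c) powr p \<le> (\<Sum>a\<in>B. \<bar>t a\<bar> powr p) / c"
      by (simp add: sum_divide_distrib)
    have "\<bar>\<Sum>a\<in>A. t a\<bar> powr p \<le> (\<Sum>a\<in>B. \<bar>t a\<bar>) powr p"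
      unfolding s1 using p by (intro powr_mono2) auto
    also have "\<dots> = c powr p * ((\<Sum>a\<in>B. \<bar>t a\<bar>) / c) powr p"
      using c by (simp add: powr_divide sum_nonneg)
    also have "\<dots> \<le> c powr p * ((\<Sum>a\<in>B. \<bar>t a\<bar> powr p) / c)"
      using 1 by (intro mult_left_mono) auto
    also have "\<dots> = c powr (p - 1) * (\<Sum>a\<in>B. \<bar>t a\<bar> powr p)"
      using c by (simp add: powr_diff)
    also have "\<dots> \<le> real (card A) powr (p - 1) * (\<Sum>a\<in>A. \<bar>t a\<bar> powr p)"
      unfolding c_def using B fin p
      by (intro mult_mono powr_mono2 sum_mono2 sum_nonneg) (auto intro!: card_mono)
    finally show ?thesis .
  qed
qed

lemma abs_mean_powr_le:
  fixes t :: "'b \<Rightarrow> real"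
  assumes fin: "finite A" and ne: "A \<noteq> {}" and p: "p \<ge> 1"
  shows "\<bar>(\<Sum>a\<in>A. t a) / real (card A)\<bar> powr p \<le> (\<Sum>a\<in>A. \<bar>t a\<bar> powr p) / real (card A)"
proof -
  have c: "real (card A) > 0" using fin ne by (simp add: card_gt_0_iff)
  have "\<bar>(\<Sum>a\<in>A. t a) / real (card A)\<bar> powr p = \<bar>\<Sum>a\<in>A. t a\<bar> powr p / real (card A) powr p"
    using c by (simp add: abs_divide powr_divide)
  also have "\<dots> \<le> (real (card A) powr (p - 1) * (\<Sum>a\<in>A. \<bar>t a\<bar> powr p)) / real (card A) powr p"
    by (intro divide_right_mono abs_sum_powr_le fin p) auto
  also have "\<dots> = (\<Sum>a\<in>A. \<bar>t a\<bar> powr p) / real (card A)"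
    using c by (simp add: powr_diff)
  finally show ?thesis .
qed

lemma nn_integral_lborel_translate:
  fixes g :: "'a::euclidean_space \<Rightarrow> ennreal"
  assumes [measurable]: "g \<in> borel_measurable borel"
  shows "(\<integral>\<^sup>+u. g (c + u) \<partial>lborel) = (\<integral>\<^sup>+u. g u \<partial>lborel)"
proof -
  have "(\<integral>\<^sup>+u. g u \<partial>lborel) = (\<integral>\<^sup>+u. g u \<partial>distr lborel borel ((+) c))"
    by (simp add: lborel_distr_plus)
  also have "\<dots> = (\<integral>\<^sup>+u. g (c + u) \<partial>lborel)"
    by (subst nn_integral_distr) auto
  finally show ?thesis by simp
qed

lemma le_add_powr_divide_powr:
  assumes "(l::real) > 0" "t \<ge> 0" "p \<ge> 1"
  shows "t \<le> l + t powr p / l powr (p - 1)"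
proof (cases "t \<le> l")
  case True then show ?thesis using assms by (smt (verit) divide_nonneg_nonneg powr_ge_zero)
next
  case False
  then have "t = t powr p / t powr (p - 1)" using assms by (simp add: powr_diff)
  also have "\<dots> \<le> t powr p / l powr (p - 1)"
    using False assms by (intro divide_left_mono powr_mono2 mult_pos_pos) auto
  finally show ?thesis using assms by simp
qed

text \<open>
  In the application h is a fixed multiple of the connectivity radius, \<phi> i is the value of the
  discrete function at X i, and V is the set of centres whose h-ball lies in the domain.
\<close>
locale point_cloud =
  fixes I :: "nat set" and X :: "nat \<Rightarrow> 'a::euclidean_space" and \<phi> :: "nat \<Rightarrow> real"
    and h p m \<kappa> :: real and V :: "'a set"
  assumes finite_I: "finite I" and h: "h > 0" and p: "p > real DIM('a)"
    and m: "m > 0" and \<kappa>: "\<kappa> > 0"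
    and count: "u \<in> V \<Longrightarrow> m \<le> real (card {i\<in>I. dist (X i) u \<le> h})"
    and energy: "(\<Sum>i\<in>I. \<Sum>j\<in>I. if dist (X i) (X j) \<le> 3 * h then \<bar>\<phi> i - \<phi> j\<bar> powr p else 0)
                  \<le> \<kappa> * h powr (p - real DIM('a)) * m\<^sup>2"
begin

definition edge where
  "edge i j = (if dist (X i) (X j) \<le> 3 * h then \<bar>\<phi> i - \<phi> j\<bar> powr p else 0)"

definition near where "near u = {i\<in>I. dist (X i) u \<le> h}"

definition local_mean where "local_mean u = (\<Sum>i\<in>near u. \<phi> i) / real (card (near u))"

lemma edge_nonneg [simp]: "edge i j \<ge> 0" by (simp add: edge_def)

lemma sum_edge: "(\<Sum>i\<in>I. \<Sum>j\<in>I. edge i j) \<le> \<kappa> * h powr (p - real DIM('a)) * m\<^sup>2"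
  using energy by (simp add: edge_def)

lemma p1: "p > 1"
  using p DIM_positive[where 'a='a] by linarith

lemma finite_near [simp]: "finite (near u)" using finite_I by (simp add: near_def)

lemma card_near: "u \<in> V \<Longrightarrow> m \<le> real (card (near u))" using count by (simp add: near_def)

lemma near_nonempty: assumes "u \<in> V" shows "near u \<noteq> {}"
  using card_near[OF assms] m by auto

text \<open>The difference of two means is the mean of \<open>\<phi> i - \<phi> j\<close> over all
  pairs, so Jensen's inequality applies to it. Every such pair has distance at most 3h and is
  therefore an edge.\<close>

lemma local_mean_diff:
  assumes u: "u \<in> V" and v: "v \<in> V" and uv: "dist u v \<le> h"
  shows "\<bar>local_mean u - local_mean v\<bar> powr p \<le> (\<Sum>i\<in>near u. \<Sum>j\<in>near v. edge i j) / m\<^sup>2"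
proof -
  define A where "A = near u \<times> near v"
  have ne: "A \<noteq> {}" "finite A" using near_nonempty[OF u] near_nonempty[OF v] by (auto simp: A_def)
  have cu: "real (card (near u)) > 0" and cv: "real (card (near v)) > 0"
    using card_near u v m by force+
  have cA: "real (card A) = real (card (near u)) * real (card (near v))"
    by (simp add: A_def card_cartesian_product)
  have "local_mean u - local_mean v = (\<Sum>i\<in>near u. \<Sum>j\<in>near v. (\<phi> i - \<phi> j)) / real (card A)"
  proof -
    have "(\<Sum>i\<in>near u. \<Sum>j\<in>near v. (\<phi> i - \<phi> j))
        = real (card (near v)) * sum \<phi> (near u) - real (card (near u)) * sum \<phi> (near v)"
      by (simp add: sum_subtractf sum_distrib_left)
    moreover have "card (near u) \<noteq> 0" "card (near v) \<noteq> 0" using cu cv by auto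
    ultimately show ?thesis
      unfolding local_mean_def cA by (simp add: diff_divide_distrib del: card_0_eq)
  qed
  also have "(\<Sum>i\<in>near u. \<Sum>j\<in>near v. (\<phi> i - \<phi> j)) = (\<Sum>a\<in>A. \<phi> (fst a) - \<phi> (snd a))"
    by (simp add: A_def sum.cartesian_product split_def)
  finally have "\<bar>local_mean u - local_mean v\<bar> powr p \<le> (\<Sum>a\<in>A. \<bar>\<phi> (fst a) - \<phi> (snd a)\<bar> powr p) / real (card A)"
    using abs_mean_powr_le[OF ne(2,1), of p] p1 by simp
  also have "(\<Sum>a\<in>A. \<bar>\<phi> (fst a) - \<phi> (snd a)\<bar> powr p) = (\<Sum>a\<in>A. edge (fst a) (snd a))"
  proof (rule sum.cong[OF refl])
    fix a assume "a \<in> A"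
    then have "dist (X (fst a)) u \<le> h" "dist (X (snd a)) v \<le> h" by (auto simp: A_def near_def)
    then have "dist (X (fst a)) (X (snd a)) \<le> 3 * h"
      using uv dist_triangle[of "X (fst a)" "X (snd a)" u] dist_triangle[of u "X (snd a)" v]
      by (simp add: dist_commute)
    then show "\<bar>\<phi> (fst a) - \<phi> (snd a)\<bar> powr p = edge (fst a) (snd a)" by (simp add: edge_def)
  qed
  also have "(\<Sum>a\<in>A. edge (fst a) (snd a)) = (\<Sum>i\<in>near u. \<Sum>j\<in>near v. edge i j)"
    by (simp add: A_def sum.cartesian_product split_def)
  also have "\<dots> / real (card A) \<le> \<dots> / m\<^sup>2"
  proof (rule divide_left_mono)
    show "m\<^sup>2 \<le> real (card A)" unfolding cA power2_eq_square
      using card_near[OF u] card_near[OF v] m by (intro mult_mono) auto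
  qed (use m cu cv cA in \<open>auto intro!: sum_nonneg\<close>)
  finally show ?thesis .
qed

text \<open>A crude bound by the total energy. It has the right order only at scale h, where it
  serves as the last step of the descent through dyadic radii.\<close>

lemma local_mean_diff_le:
  assumes u: "u \<in> V" and v: "v \<in> V" and uv: "dist u v \<le> h"
  shows "\<bar>local_mean u - local_mean v\<bar> powr p \<le> \<kappa> * h powr (p - real DIM('a))"
proof -
  have "(\<Sum>i\<in>near u. \<Sum>j\<in>near v. edge i j) \<le> (\<Sum>i\<in>I. \<Sum>j\<in>I. edge i j)"
    by (rule order_trans[OF sum_mono[OF sum_mono2] sum_mono2])
       (auto simp: near_def finite_I intro!: sum_nonneg)
  also note sum_edge
  finally have "(\<Sum>i\<in>near u. \<Sum>j\<in>near v. edge i j) / m\<^sup>2 \<le> \<kappa> * h powr (p - real DIM('a)) * m\<^sup>2 / m\<^sup>2"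
    by (intro divide_right_mono) auto
  with local_mean_diff[OF assms] show ?thesis using m by simp
qed

text \<open>Here only one of the two points is averaged, so one division by \<open>m\<close> is lost
  compared with the bound for two means. This is the only source of the error term n
  \<epsilon>^p.\<close>

lemma phi_local_mean_diff:
  assumes u: "u \<in> V" and i: "i \<in> I" and iu: "dist (X i) u \<le> h"
  shows "\<bar>\<phi> i - local_mean u\<bar> powr p \<le> \<kappa> * h powr (p - real DIM('a)) * m"
proof -
  have cu: "real (card (near u)) > 0" using card_near u m by force
  have "\<phi> i - local_mean u = (\<Sum>j\<in>near u. (\<phi> i - \<phi> j)) / real (card (near u))"
    unfolding local_mean_def using cu by (simp add: sum_subtractf diff_divide_distrib del: card_0_eq)
  then have "\<bar>\<phi> i - local_mean u\<bar> powr p \<le> (\<Sum>j\<in>near u. \<bar>\<phi> i - \<phi> j\<bar> powr p) / real (card (near u))"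
    using abs_mean_powr_le[OF finite_near near_nonempty[OF u], of p] p1 by simp
  also have "(\<Sum>j\<in>near u. \<bar>\<phi> i - \<phi> j\<bar> powr p) = (\<Sum>j\<in>near u. edge i j)"
  proof (rule sum.cong[OF refl])
    fix j assume "j \<in> near u"
    then have "dist (X i) (X j) \<le> 3 * h" using iu h
      dist_triangle[of "X i" "X j" u] by (simp add: near_def dist_commute)
    then show "\<bar>\<phi> i - \<phi> j\<bar> powr p = edge i j" by (simp add: edge_def)
  qed
  also have "\<dots> / real (card (near u)) \<le> \<dots> / m"
    by (intro divide_left_mono card_near u) (use m cu in \<open>auto intro!: sum_nonneg\<close>)
  also have "\<dots> \<le> (\<Sum>j\<in>I. edge i j) / m"
    using m by (intro divide_right_mono sum_mono2 finite_I) (auto simp: near_def)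
  also have "(\<Sum>j\<in>I. edge i j) \<le> (\<Sum>i\<in>I. \<Sum>j\<in>I. edge i j)"
    by (rule member_le_sum[OF i]) (auto simp: finite_I intro!: sum_nonneg)
  also note sum_edge
  finally show ?thesis using m by (simp add: divide_right_mono power2_eq_square)
qed

text \<open>A quotient of finite sums of indicators, from which measurability in the centre is
  immediate. A centre without near points gives 0 / 0 = 0 on both sides.\<close>

lemma local_mean_eq: "local_mean u = (\<Sum>i\<in>I. \<phi> i * indicator (cball (X i) h) u) / (\<Sum>i\<in>I. indicator (cball (X i) h) u)"
proof -
  have "(\<Sum>i\<in>I. \<phi> i * indicator (cball (X i) h) u) = (\<Sum>i\<in>near u. \<phi> i)"
    unfolding near_def by (rule sum.mono_neutral_cong_right) (auto simp: finite_I)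
  moreover have "(\<Sum>i\<in>I. indicator (cball (X i) h) u) = (\<Sum>i\<in>near u. 1::real)"
    unfolding near_def by (rule sum.mono_neutral_cong_right) (auto simp: finite_I)
  ultimately show ?thesis by (simp add: local_mean_def)
qed

lemma local_mean_measurable [measurable]: "local_mean \<in> borel_measurable borel"
  unfolding local_mean_eq[abs_def]
  by (intro borel_measurable_divide borel_measurable_sum borel_measurable_times
      borel_measurable_const borel_measurable_indicator) auto

lemma local_mean_bounded: "\<bar>local_mean u\<bar> \<le> (\<Sum>i\<in>I. \<bar>\<phi> i\<bar>)"
proof (cases "near u = {}")
  case True then show ?thesis by (simp add: local_mean_def sum_nonneg)
next
  case False
  then have c: "real (card (near u)) \<ge> 1" by (simp add: Suc_leI card_gt_0_iff)
  have "\<bar>local_mean u\<bar> = \<bar>\<Sum>i\<in>near u. \<phi> i\<bar> / real (card (near u))" by (simp add: local_mean_def abs_divide)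
  also have "\<dots> \<le> \<bar>\<Sum>i\<in>near u. \<phi> i\<bar> / 1" using c by (intro divide_left_mono) auto
  also have "\<dots> \<le> (\<Sum>i\<in>near u. \<bar>\<phi> i\<bar>)" by (simp add: sum_abs)
  also have "\<dots> \<le> (\<Sum>i\<in>I. \<bar>\<phi> i\<bar>)" by (intro sum_mono2 finite_I) (auto simp: near_def)
  finally show ?thesis .
qed

text \<open>After \<open>local_mean_diff\<close>, the edge i, j contributes only for
  \<open>u\<close> within h of \<open>X j\<close>. Integrating over \<open>u\<close> replaces the
  supremum by the volume of that ball, and h^(p-d) h^d = h^p.\<close>

lemma shift_estimate:
  assumes w: "norm w \<le> h" and U: "\<And>u. u \<in> U \<Longrightarrow> u \<in> V \<and> u + w \<in> V"
  shows "(\<integral>\<^sup>+u. ennreal (\<bar>local_mean (u + w) - local_mean u\<bar> powr p) * indicator U u \<partial>lborel)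
           \<le> ennreal (\<kappa> * unit_ball_vol (real DIM('a)) * h powr p)"
proof -
  have [measurable]: "cball (X j) h \<in> sets borel" for j by simp
  have "(\<integral>\<^sup>+u. ennreal (\<bar>local_mean (u + w) - local_mean u\<bar> powr p) * indicator U u \<partial>lborel)
     \<le> (\<integral>\<^sup>+u. (\<Sum>i\<in>I. \<Sum>j\<in>I. ennreal (edge i j / m\<^sup>2) * indicator (cball (X j) h) u) \<partial>lborel)"
  proof (rule nn_integral_mono)
    fix u
    show "ennreal (\<bar>local_mean (u + w) - local_mean u\<bar> powr p) * indicator U u
      \<le> (\<Sum>i\<in>I. \<Sum>j\<in>I. ennreal (edge i j / m\<^sup>2) * indicator (cball (X j) h) u)"
    proof (cases "u \<in> U")
      case True
      have "\<bar>local_mean (u + w) - local_mean u\<bar> powr p \<le> (\<Sum>i\<in>near (u + w). \<Sum>j\<in>near u. edge i j) / m\<^sup>2"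
        using U[OF True] w by (intro local_mean_diff) (auto simp: dist_norm)
      also have "(\<Sum>i\<in>near (u + w). \<Sum>j\<in>near u. edge i j)
         \<le> (\<Sum>i\<in>I. \<Sum>j\<in>I. edge i j * indicator (cball (X j) h) u)"
      proof -
        have "(\<Sum>j\<in>near u. edge i j) = (\<Sum>j\<in>I. edge i j * indicator (cball (X j) h) u)" for i
          unfolding near_def by (rule sum.mono_neutral_cong_left) (auto simp: finite_I)
        then show ?thesis
          by (auto simp: near_def finite_I intro!: sum_mono2 sum_nonneg)
      qed
      finally have "\<bar>local_mean (u + w) - local_mean u\<bar> powr p
         \<le> (\<Sum>i\<in>I. \<Sum>j\<in>I. edge i j / m\<^sup>2 * indicator (cball (X j) h) u)"
        using m by (simp add: divide_right_mono sum_divide_distrib)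
      then have "ennreal (\<bar>local_mean (u + w) - local_mean u\<bar> powr p)
         \<le> ennreal (\<Sum>i\<in>I. \<Sum>j\<in>I. edge i j / m\<^sup>2 * indicator (cball (X j) h) u)"
        by (rule ennreal_leI)
      also have "\<dots> = (\<Sum>i\<in>I. \<Sum>j\<in>I. ennreal (edge i j / m\<^sup>2) * indicator (cball (X j) h) u)"
        by (simp add: sum_nonneg ennreal_mult''[symmetric] ennreal_indicator[symmetric])
      finally show ?thesis using True by simp
    qed simp
  qed
  also have "\<dots> = (\<Sum>i\<in>I. \<Sum>j\<in>I. ennreal (edge i j / m\<^sup>2) * ennreal (unit_ball_vol (real DIM('a)) * h ^ DIM('a)))"
    using h by (subst nn_integral_sum, measurable, intro sum.cong refl, subst nn_integral_sum, measurable,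
       intro sum.cong refl, subst nn_integral_cmult_indicator) (auto simp: emeasure_cball)
  also have "\<dots> = ennreal (\<Sum>i\<in>I. \<Sum>j\<in>I. edge i j / m\<^sup>2 * (unit_ball_vol (real DIM('a)) * h ^ DIM('a)))"
    using h by (simp add: sum_nonneg ennreal_mult''[symmetric])
  also have "(\<Sum>i\<in>I. \<Sum>j\<in>I. edge i j / m\<^sup>2 * (unit_ball_vol (real DIM('a)) * h ^ DIM('a))) = (\<Sum>i\<in>I. \<Sum>j\<in>I. edge i j) * (unit_ball_vol (real DIM('a)) * h ^ DIM('a) / m\<^sup>2)"
    by (simp add: sum_distrib_left sum_distrib_right sum_divide_distrib mult_ac)
  also have "\<dots> \<le> (\<kappa> * h powr (p - real DIM('a)) * m\<^sup>2) * (unit_ball_vol (real DIM('a)) * h ^ DIM('a) / m\<^sup>2)"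
    using h by (intro mult_right_mono sum_edge) auto
  also have "\<dots> = \<kappa> * unit_ball_vol (real DIM('a)) * (h powr (p - real DIM('a)) * h powr real DIM('a))"
    using m h by (simp add: powr_realpow)
  also have "h powr (p - real DIM('a)) * h powr real DIM('a) = h powr p"
    by (simp flip: powr_add)
  finally show ?thesis by (simp add: ennreal_leI)
qed

text \<open>
  N steps of length at most h. The convexity bound costs exactly N powr p, which is what gives the
  correct scaling in the radius below.
\<close>
lemma chain_estimate:
  assumes B: "convex B" "B \<subseteq> V" and [measurable]: "B \<in> sets borel"
    and N: "N \<ge> 1" and z: "norm z \<le> real N * h"
  shows "(\<integral>\<^sup>+u. ennreal (\<bar>local_mean (u + z) - local_mean u\<bar> powr p) * indicator B u * indicator B (u + z) \<partial>lborel)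
           \<le> ennreal (real N powr p * (\<kappa> * unit_ball_vol (real DIM('a)) * h powr p))"
proof -
  let ?K = "\<kappa> * unit_ball_vol (real DIM('a)) * h powr p"
  define w where "w = z /\<^sub>R real N"
  define g where "g u = ennreal (\<bar>local_mean (u + w) - local_mean u\<bar> powr p) * indicator {u\<in>B. u + w \<in> B} u" for u
  have w: "norm w \<le> h" using z N by (simp add: w_def field_simps)
  have [measurable]: "g \<in> borel_measurable borel" unfolding g_def by measurable
  have path: "u + (real k) *\<^sub>R w \<in> B" if "u \<in> B" "u + z \<in> B" "k \<le> N" for u k
  proof -
    have "(1 - real k / real N) *\<^sub>R u + (real k / real N) *\<^sub>R (u + z) \<in> B"
      using that N by (intro convexD[OF B(1)]) (auto simp: field_simps)
    moreover have "(1 - real k / real N) *\<^sub>R u + (real k / real N) *\<^sub>R (u + z) = u + (real k) *\<^sub>R w"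
      by (simp add: w_def algebra_simps divide_inverse)
    ultimately show ?thesis by simp
  qed
  have "(\<integral>\<^sup>+u. ennreal (\<bar>local_mean (u + z) - local_mean u\<bar> powr p) * indicator B u * indicator B (u + z) \<partial>lborel)
     \<le> (\<integral>\<^sup>+u. (\<Sum>k<N. ennreal (real N powr (p - 1)) * g (real k *\<^sub>R w + u)) \<partial>lborel)"
  proof (rule nn_integral_mono)
    fix u
    show "ennreal (\<bar>local_mean (u + z) - local_mean u\<bar> powr p) * indicator B u * indicator B (u + z)
       \<le> (\<Sum>k<N. ennreal (real N powr (p - 1)) * g (real k *\<^sub>R w + u))"
    proof (cases "u \<in> B \<and> u + z \<in> B")
      case True
      have "local_mean (u + z) - local_mean u = (\<Sum>k<N. local_mean (u + real (Suc k) *\<^sub>R w) - local_mean (u + real k *\<^sub>R w))"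
        using N by (subst sum_lessThan_telescope) (simp add: w_def)
      then have "\<bar>local_mean (u + z) - local_mean u\<bar> powr p
         \<le> real N powr (p - 1) * (\<Sum>k<N. \<bar>local_mean (u + real (Suc k) *\<^sub>R w) - local_mean (u + real k *\<^sub>R w)\<bar> powr p)"
        using abs_sum_powr_le[of "{..<N}" p] p1 by simp
      then have "ennreal (\<bar>local_mean (u + z) - local_mean u\<bar> powr p)
         \<le> ennreal (\<Sum>k<N. real N powr (p - 1) * \<bar>local_mean (u + real (Suc k) *\<^sub>R w) - local_mean (u + real k *\<^sub>R w)\<bar> powr p)"
        by (intro ennreal_leI) (simp add: sum_distrib_left)
      also have "\<dots> = (\<Sum>k<N. ennreal (real N powr (p - 1)) *
                 ennreal (\<bar>local_mean (u + real (Suc k) *\<^sub>R w) - local_mean (u + real k *\<^sub>R w)\<bar> powr p))"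
        by (subst sum_ennreal[symmetric]) (auto simp: ennreal_mult')
      also have "\<dots> = (\<Sum>k<N. ennreal (real N powr (p - 1)) * g (real k *\<^sub>R w + u))"
      proof (rule sum.cong[OF refl])
        fix k assume "k \<in> {..<N}"
        then have "u + real k *\<^sub>R w \<in> B" "u + real (Suc k) *\<^sub>R w \<in> B"
          using True by (intro path; simp)+
        then show "ennreal (real N powr (p - 1)) *
                 ennreal (\<bar>local_mean (u + real (Suc k) *\<^sub>R w) - local_mean (u + real k *\<^sub>R w)\<bar> powr p)
              = ennreal (real N powr (p - 1)) * g (real k *\<^sub>R w + u)"
          by (simp add: g_def algebra_simps)
      qed
      finally show ?thesis using True by simp
    qed auto
  qed
  \<comment> \<open>By translation invariance all N steps have the same integral, hence the total
    factor N N^(p-1) = N^p.\<close>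
  also have "\<dots> = (\<Sum>k<N. ennreal (real N powr (p - 1)) * (\<integral>\<^sup>+u. g u \<partial>lborel))"
    by (simp add: nn_integral_sum nn_integral_cmult nn_integral_lborel_translate)
  also have "\<dots> \<le> (\<Sum>k<N. ennreal (real N powr (p - 1)) * ennreal ?K)"
    unfolding g_def using w B(2) by (intro sum_mono mult_left_mono shift_estimate) auto
  also have "\<dots> = ennreal (real N * (real N powr (p - 1) * ?K))"
    using \<kappa> by (simp add: ennreal_mult' ennreal_of_nat_eq_real_of_nat)
  also have "real N * (real N powr (p - 1) * ?K) = real N powr p * ?K"
    using N by (simp add: powr_diff)
  finally show ?thesis .
qed

text \<open>Substituting v = u + z and exchanging the integrals reduces the claim to shifts with |z|
  < 2R, each treated by a chain of N steps. Since N is at most 3R/h, the product N^p h^p is at most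
  (3R)^p: the small scale h cancels and the continuum scaling in R remains.\<close>

lemma poincare:
  assumes B: "ball c R \<subseteq> V" and R: "R \<ge> h"
  shows "(\<integral>\<^sup>+u. \<integral>\<^sup>+v. ennreal (\<bar>local_mean v - local_mean u\<bar> powr p) * indicator (ball c R) u * indicator (ball c R) v \<partial>lborel \<partial>lborel)
    \<le> ennreal (\<kappa> * (unit_ball_vol (real DIM('a)))\<^sup>2 * 2 ^ DIM('a) * 3 powr p * R powr (p + real DIM('a)))"
proof -
  let ?K = "\<kappa> * unit_ball_vol (real DIM('a)) * h powr p"
  let ?v = "unit_ball_vol (real DIM('a))"
  \<comment> \<open>Rounding up adds less than 1, which is at most R/h; so N h is at least 2R while
    N is at most 3R/h.\<close>
  define N where "N = nat \<lceil>2 * R / h\<rceil>"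
  have Rh: "R > 0" "R / h \<ge> 1" using R h by auto
  have N_eq: "real N = of_int \<lceil>2 * R / h\<rceil>" using Rh h by (simp add: N_def)
  have N1: "real N \<ge> 2 * R / h" unfolding N_eq by linarith
  have N2: "real N \<le> 3 * (R / h)" unfolding N_eq using Rh(2) by linarith
  have N0: "N \<ge> 1" using N1 Rh by linarith
  have Nh: "2 * R \<le> real N * h" using N1 h by (simp add: field_simps)
  have [measurable]: "ball c R \<in> sets borel" by simp
  define G where "G u v = ennreal (\<bar>local_mean v - local_mean u\<bar> powr p) * indicator (ball c R) u * indicator (ball c R) v" for u v
  have G1 [measurable]: "G u \<in> borel_measurable borel" for u
    unfolding G_def[abs_def] by measurable
  have G2: "(\<lambda>(z, u). G u (u + z)) \<in> borel_measurable (lborel \<Otimes>\<^sub>M lborel)"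
    unfolding G_def by measurable
  have "(\<integral>\<^sup>+u. \<integral>\<^sup>+v. G u v \<partial>lborel \<partial>lborel) = (\<integral>\<^sup>+u. \<integral>\<^sup>+z. G u (u + z) \<partial>lborel \<partial>lborel)"
    by (simp add: nn_integral_lborel_translate)
  also have "\<dots> = (\<integral>\<^sup>+z. \<integral>\<^sup>+u. G u (u + z) \<partial>lborel \<partial>lborel)"
    by (rule lborel_pair.Fubini'[OF G2])
  also have "\<dots> \<le> (\<integral>\<^sup>+z. ennreal (real N powr p * ?K) * indicator (ball (0::'a) (2 * R)) z \<partial>lborel)"
  proof (rule nn_integral_mono)
    fix z :: 'a
    show "(\<integral>\<^sup>+u. G u (u + z) \<partial>lborel) \<le> ennreal (real N powr p * ?K) * indicator (ball 0 (2 * R)) z"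
    proof (cases "norm z < 2 * R")
      case True
      then show ?thesis
        using chain_estimate[of "ball c R" N z] B N0 Nh by (simp add: G_def)
    next
      case False
      have "G u (u + z) = 0" for u
      proof -
        have "\<not> (u \<in> ball c R \<and> u + z \<in> ball c R)"
        proof
          assume "u \<in> ball c R \<and> u + z \<in> ball c R"
          then have "dist u (u + z) < 2 * R" using dist_triangle[of u "u + z" c] by (auto simp: dist_commute)
          then show False using False by (simp add: dist_norm)
        qed
        then show ?thesis by (auto simp: G_def)
      qed
      then show ?thesis by simp
    qed
  qed
  also have "\<dots> = ennreal (real N powr p * ?K) * ennreal (?v * (2 * R) ^ DIM('a))"
    using Rh by (subst nn_integral_cmult_indicator) (simp_all add: emeasure_ball)
  also have "\<dots> = ennreal ((real N powr p * ?K) * (?v * (2 * R) ^ DIM('a)))"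
    using \<kappa> Rh by (intro ennreal_mult[symmetric]) auto
  also have "\<dots> \<le> ennreal ((3 * (R / h)) powr p * ?K * (?v * (2 * R) ^ DIM('a)))"
    using N2 p1 \<kappa> Rh by (intro ennreal_leI mult_right_mono powr_mono2) auto
  also have "(3 * (R / h)) powr p * ?K * (?v * (2 * R) ^ DIM('a))
      = \<kappa> * ?v\<^sup>2 * 2 ^ DIM('a) * 3 powr p * (R powr p * R powr real DIM('a))"
    using Rh h by (simp add: powr_mult powr_divide powr_realpow power2_eq_square power_mult_distrib)
  also have "R powr p * R powr real DIM('a) = R powr (p + real DIM('a))" by (simp add: powr_add)
  finally show ?thesis unfolding G_def .
qed

definition mean where "mean A = (\<integral>u. indicator A u * local_mean u \<partial>lborel) / measure lborel A"

lemma integrable_local_mean: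
  assumes "A \<in> sets borel" "emeasure lborel A < \<infinity>"
  shows "integrable lborel (\<lambda>u. indicator A u * local_mean u)"
proof -
  have "integrable lborel (\<lambda>u. indicator A u *\<^sub>R local_mean u)"
    by (rule integrableI_bounded_set_indicator[where B="\<Sum>i\<in>I. \<bar>\<phi> i\<bar>"])
       (use assms local_mean_bounded in auto)
  then show ?thesis by simp
qed

text \<open>
  Instead of Jensen's inequality, |t| is split as l + |t|^p / l^(p-1), at the cost of a factor 2.
\<close>
lemma mean_diff:
  assumes A: "A \<in> sets borel" "emeasure lborel A < \<infinity>" "measure lborel A > 0"
    and B: "B \<in> sets borel" "emeasure lborel B < \<infinity>" "measure lborel B > 0"
    and l: "l > 0"
    and le: "(\<integral>\<^sup>+u. \<integral>\<^sup>+v. ennreal (\<bar>local_mean v - local_mean u\<bar> powr p) * indicator A u * indicator B v \<partial>lborel \<partial>lborel)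
       \<le> ennreal (l powr p * measure lborel A * measure lborel B)"
  shows "\<bar>mean A - mean B\<bar> \<le> 2 * l"
proof -
  define a b where "a = measure lborel A" and "b = measure lborel B"
  note [measurable] = A(1) B(1)
  have ea: "emeasure lborel A = ennreal a" using A(2) by (simp add: a_def emeasure_eq_ennreal_measure)
  have eb: "emeasure lborel B = ennreal b" using B(2) by (simp add: b_def emeasure_eq_ennreal_measure)
  have ab: "a > 0" "b > 0" using A B by (auto simp: a_def b_def)
  define IA IB where "IA = (\<integral>u. indicator A u * local_mean u \<partial>lborel)" and "IB = (\<integral>u. indicator B u * local_mean u \<partial>lborel)"
  note iA = integrable_local_mean[OF A(1,2)] and iB = integrable_local_mean[OF B(1,2)]
  have cA: "integrable lborel (\<lambda>u. indicator A u * (c::real))" for c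
    using A by (intro integrable_mult_left integrable_real_indicator) auto
  have cB: "integrable lborel (\<lambda>u. indicator B u * (c::real))" for c
    using B by (intro integrable_mult_left integrable_real_indicator) auto
  \<comment> \<open>The inner average is taken first: after scaling by b, the value at
    \<open>u\<close> minus the mean over B is an integral over \<open>v\<close> of
    differences.\<close>
  have inner: "ennreal \<bar>b * local_mean u - IB\<bar> \<le> (\<integral>\<^sup>+v. ennreal \<bar>local_mean v - local_mean u\<bar> * indicator B v \<partial>lborel)" for u
  proof -
    have eq: "indicator B v * (local_mean u - local_mean v) = indicator B v * local_mean u - indicator B v * local_mean v" for v
      by (simp add: algebra_simps)
    have int: "integrable lborel (\<lambda>v. indicator B v * (local_mean u - local_mean v))"
      unfolding eq using cB iB by (intro Bochner_Integration.integrable_diff) auto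
    have "b * local_mean u - IB = (\<integral>v. indicator B v * (local_mean u - local_mean v) \<partial>lborel)"
      unfolding eq IB_def
      using B by (subst Bochner_Integration.integral_diff[OF cB iB]) (simp add: b_def)
    then have "ennreal \<bar>b * local_mean u - IB\<bar> \<le> (\<integral>\<^sup>+v. ennreal \<bar>indicator B v * (local_mean u - local_mean v)\<bar> \<partial>lborel)"
      using integral_norm_bound_ennreal[OF int] by simp
    also have "\<dots> = (\<integral>\<^sup>+v. ennreal \<bar>local_mean v - local_mean u\<bar> * indicator B v \<partial>lborel)"
      by (intro nn_integral_cong) (auto simp: indicator_def)
    finally show ?thesis .
  qed
  have eq: "indicator A u * (b * local_mean u - IB) = b * (indicator A u * local_mean u) - indicator A u * IB" for u
    by (simp add: algebra_simps)
  have int: "integrable lborel (\<lambda>u. indicator A u * (b * local_mean u - IB))"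
    unfolding eq using cA iA by (intro Bochner_Integration.integrable_diff) auto
  have "a * b * (mean A - mean B) = b * IA - a * IB"
    using ab by (simp add: mean_def a_def b_def IA_def IB_def right_diff_distrib)
  also have "\<dots> = (\<integral>u. indicator A u * (b * local_mean u - IB) \<partial>lborel)"
    unfolding eq IA_def
    using A iA cA by (subst Bochner_Integration.integral_diff) (auto simp: a_def)
  finally have "ennreal \<bar>a * b * (mean A - mean B)\<bar> \<le> (\<integral>\<^sup>+u. ennreal \<bar>indicator A u * (b * local_mean u - IB)\<bar> \<partial>lborel)"
    using integral_norm_bound_ennreal[OF int] by simp
  also have "\<dots> = (\<integral>\<^sup>+u. ennreal \<bar>b * local_mean u - IB\<bar> * indicator A u \<partial>lborel)"
    by (intro nn_integral_cong) (auto simp: indicator_def)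
  also have "\<dots> \<le> (\<integral>\<^sup>+u. (\<integral>\<^sup>+v. ennreal \<bar>local_mean v - local_mean u\<bar> * indicator B v \<partial>lborel) * indicator A u \<partial>lborel)"
    by (intro nn_integral_mono mult_right_mono inner) auto
  also have "\<dots> = (\<integral>\<^sup>+u. \<integral>\<^sup>+v. ennreal \<bar>local_mean v - local_mean u\<bar> * indicator A u * indicator B v \<partial>lborel \<partial>lborel)"
    by (intro nn_integral_cong) (auto simp: indicator_def)
  also have "\<dots> \<le> (\<integral>\<^sup>+u. \<integral>\<^sup>+v. ennreal l * indicator A u * indicator B v
       + ennreal (1 / l powr (p - 1)) * (ennreal (\<bar>local_mean v - local_mean u\<bar> powr p) * indicator A u * indicator B v) \<partial>lborel \<partial>lborel)"
  proof (intro nn_integral_mono)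
    fix u v
    have "ennreal \<bar>local_mean v - local_mean u\<bar> \<le> ennreal (l + 1 / l powr (p - 1) * \<bar>local_mean v - local_mean u\<bar> powr p)"
      using le_add_powr_divide_powr[OF l, of "\<bar>local_mean v - local_mean u\<bar>" p] p1 by (intro ennreal_leI) auto
    also have "\<dots> = ennreal l + ennreal (1 / l powr (p - 1)) * ennreal (\<bar>local_mean v - local_mean u\<bar> powr p)"
      using l by (simp add: ennreal_mult'[symmetric] ennreal_plus)
    finally show "ennreal \<bar>local_mean v - local_mean u\<bar> * indicator A u * indicator B v \<le> ennreal l * indicator A u * indicator B v
       + ennreal (1 / l powr (p - 1)) * (ennreal (\<bar>local_mean v - local_mean u\<bar> powr p) * indicator A u * indicator B v)"
      by (auto simp: indicator_def)
  qed
  also have "\<dots> = ennreal l * ennreal a * ennreal b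
      + ennreal (1 / l powr (p - 1)) * (\<integral>\<^sup>+u. \<integral>\<^sup>+v. ennreal (\<bar>local_mean v - local_mean u\<bar> powr p) * indicator A u * indicator B v \<partial>lborel \<partial>lborel)"
    by (simp add: nn_integral_add nn_integral_cmult nn_integral_multc ea eb)
  \<comment> \<open>Both parts of the split contribute at most l a b: the first by its constant
    value, the second by the hypothesis \<open>le\<close>.\<close>
  also have "\<dots> \<le> ennreal l * ennreal a * ennreal b + ennreal (1 / l powr (p - 1)) * ennreal (l powr p * a * b)"
    using le unfolding a_def b_def by (intro add_left_mono mult_left_mono) auto
  also have "\<dots> = ennreal (l * a * b + 1 / l powr (p - 1) * (l powr p * a * b))"
    using ab l by (simp add: ennreal_mult'[symmetric] ennreal_plus[symmetric] del: ennreal_plus)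
  also have "l * a * b + 1 / l powr (p - 1) * (l powr p * a * b) = a * b * (2 * l)"
    using l by (simp add: powr_diff)
  finally have "a * b * \<bar>mean A - mean B\<bar> \<le> a * b * (2 * l)"
    using ab l by (simp add: abs_mult)
  then show ?thesis using ab by simp
qed

end

text \<open>
  The numerator is the Poincare constant for comparing averages over balls of radius at least R/4
  inside a ball of radius R; the denominator sums the geometric series over dyadic radii.
\<close>
definition morrey_const :: "nat \<Rightarrow> real \<Rightarrow> real \<Rightarrow> real" where
  "morrey_const d p \<kappa> =
     3 * (\<kappa> * 32 ^ d * 3 powr p) powr (1 / p) / (1 - (1/2) powr (1 - real d / p))"

context point_cloud begin

lemma gamma: "0 < 1 - real DIM('a) / p" "1 - real DIM('a) / p < 1"
  using p p1 by auto

lemma powr_gamma: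
  assumes "c \<ge> 0" "R > 0"
  shows "(c * R powr (p - real DIM('a))) powr (1 / p) = c powr (1 / p) * R powr (1 - real DIM('a) / p)"
  using assms p1 by (simp add: powr_mult powr_powr diff_divide_distrib)

text \<open>The Poincare bound on the large ball dominates the double integral over the two smaller
  ones. The constant is 32^d = 2^d 4^d 4^d: 2^d from the volume of the shifts |z| < 2R, and 4^d from
  each radius being at least R/4.\<close>

lemma mean_balls:
  fixes a b c :: 'a
  assumes "ball a r \<subseteq> ball c R" "ball b s \<subseteq> ball c R" "ball c R \<subseteq> V" "R \<ge> h"
    and r: "r \<ge> R / 4" and s: "s \<ge> R / 4"
  shows "\<bar>mean (ball a r) - mean (ball b s)\<bar>
     \<le> 2 * (\<kappa> * 32 ^ DIM('a) * 3 powr p) powr (1 / p) * R powr (1 - real DIM('a) / p)"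
proof -
  let ?v = "unit_ball_vol (real DIM('a))"
  have R: "R > 0" using h \<open>R \<ge> h\<close> by linarith
  have rs: "r > 0" "s > 0" using R r s by linarith+
  \<comment> \<open>Chosen so that l^p times the volumes of the two balls dominates the Poincare
    bound.\<close>
  define l where "l = (\<kappa> * 32 ^ DIM('a) * 3 powr p) powr (1 / p) * R powr (1 - real DIM('a) / p)"
  have l: "l > 0" using \<kappa> R by (simp add: l_def)
  have lp: "l powr p = \<kappa> * 32 ^ DIM('a) * 3 powr p * R powr (p - real DIM('a))"
    unfolding l_def using \<kappa> p1 R by (subst powr_gamma[symmetric]) (auto simp: powr_powr)
  have ma: "measure lborel (ball x t) = ?v * t ^ DIM('a)" if "t > 0" for x :: 'a and t
    using that by (simp add: measure_def emeasure_ball)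
  have "\<bar>mean (ball a r) - mean (ball b s)\<bar> \<le> 2 * l"
  proof (rule mean_diff[OF _ _ _ _ _ _ l])
    have "(\<integral>\<^sup>+u. \<integral>\<^sup>+v. ennreal (\<bar>local_mean v - local_mean u\<bar> powr p) * indicator (ball a r) u * indicator (ball b s) v \<partial>lborel \<partial>lborel)
       \<le> (\<integral>\<^sup>+u. \<integral>\<^sup>+v. ennreal (\<bar>local_mean v - local_mean u\<bar> powr p) * indicator (ball c R) u * indicator (ball c R) v \<partial>lborel \<partial>lborel)"
      using assms(1,2) by (intro nn_integral_mono mult_mono) (auto simp: indicator_def split: if_splits)
    also have "\<dots> \<le> ennreal (\<kappa> * ?v\<^sup>2 * 2 ^ DIM('a) * 3 powr p * R powr (p + real DIM('a)))"
      by (rule poincare) fact+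
    also have "\<dots> \<le> ennreal (l powr p * measure lborel (ball a r) * measure lborel (ball b s))"
    proof (rule ennreal_leI)
      have "R powr (p + real DIM('a)) = R powr (p - real DIM('a)) * (R ^ DIM('a) * R ^ DIM('a))"
        using R by (simp add: powr_diff powr_add powr_realpow)
      also have "R ^ DIM('a) * R ^ DIM('a) = 16 ^ DIM('a) * ((R / 4) ^ DIM('a) * (R / 4) ^ DIM('a))"
        by (simp add: power_mult_distrib[symmetric])
      finally have "\<kappa> * ?v\<^sup>2 * 2 ^ DIM('a) * 3 powr p * R powr (p + real DIM('a))
          = \<kappa> * (2 ^ DIM('a) * 16 ^ DIM('a)) * 3 powr p * R powr (p - real DIM('a)) * ?v\<^sup>2 *
            ((R / 4) ^ DIM('a) * (R / 4) ^ DIM('a))"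
        by (simp add: mult_ac)
      also have "2 ^ DIM('a) * 16 ^ DIM('a) = (32::real) ^ DIM('a)"
        by (simp add: power_mult_distrib[symmetric])
      also have "\<kappa> * 32 ^ DIM('a) * 3 powr p * R powr (p - real DIM('a)) * ?v\<^sup>2 *
            ((R / 4) ^ DIM('a) * (R / 4) ^ DIM('a)) \<le>
           \<kappa> * 32 ^ DIM('a) * 3 powr p * R powr (p - real DIM('a)) * ?v\<^sup>2 *
            (r ^ DIM('a) * s ^ DIM('a))"
        using r s R rs \<kappa> by (intro mult_left_mono mult_mono power_mono) auto
      also have "\<dots> = l powr p * measure lborel (ball a r) * measure lborel (ball b s)"
        unfolding lp using rs by (simp add: ma power2_eq_square)
      finally show "\<kappa> * ?v\<^sup>2 * 2 ^ DIM('a) * 3 powr p * R powr (p + real DIM('a))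
         \<le> l powr p * measure lborel (ball a r) * measure lborel (ball b s)" .
    qed
    finally show "(\<integral>\<^sup>+u. \<integral>\<^sup>+v. ennreal (\<bar>local_mean v - local_mean u\<bar> powr p) * indicator (ball a r) u * indicator (ball b s) v \<partial>lborel \<partial>lborel)
       \<le> ennreal (l powr p * measure lborel (ball a r) * measure lborel (ball b s))" .
  qed (use rs in \<open>auto simp: ma emeasure_ball\<close>)
  then show ?thesis by (simp add: l_def)
qed

lemma abs_diff_mean_le:
  assumes A: "A \<in> sets borel" "emeasure lborel A < \<infinity>" "measure lborel A > 0"
    and le: "\<And>v. v \<in> A \<Longrightarrow> \<bar>local_mean v - c\<bar> \<le> l"
  shows "\<bar>c - mean A\<bar> \<le> l"
proof -
  have int: "integrable lborel (\<lambda>u. indicator A u * (t::real))" for t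
    using A by (intro integrable_mult_left integrable_real_indicator) auto
  have eq: "(\<integral>u. indicator A u * t \<partial>lborel) = t * measure lborel A" for t
    using A by simp
  have "(\<integral>u. indicator A u * local_mean u \<partial>lborel) \<le> (\<integral>u. indicator A u * (c + l) \<partial>lborel)"
    using le by (intro integral_mono integrable_local_mean A int) (force simp: indicator_def)
  then have "(\<integral>u. indicator A u * local_mean u \<partial>lborel) \<le> (c + l) * measure lborel A" unfolding eq .
  moreover have "(\<integral>u. indicator A u * (c - l) \<partial>lborel) \<le> (\<integral>u. indicator A u * local_mean u \<partial>lborel)"
    using le by (intro integral_mono integrable_local_mean A int) (force simp: indicator_def)
  then have "(c - l) * measure lborel A \<le> (\<integral>u. indicator A u * local_mean u \<partial>lborel)" unfolding eq .
  ultimately have "mean A \<le> c + l" "c - l \<le> mean A"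
    using A(3) by (simp_all add: mean_def field_simps)
  then show ?thesis by linarith
qed

text \<open>Telescoping over R, R/2, R/4, ... down to a radius in [h, 2h), arranged as an induction
  that reproduces its own bound. With \<gamma> = 1 - d/p, one halving costs 2 D R^\<gamma>, and M (1
  - 2^(-\<gamma>)) = 3 D pays for it.\<close>

lemma local_mean_ball_mean:
  assumes "h \<le> R" "ball u R \<subseteq> V"
  shows "\<bar>local_mean u - mean (ball u R)\<bar> \<le> morrey_const DIM('a) p \<kappa> * R powr (1 - real DIM('a) / p)"
proof -
  define \<gamma> where "\<gamma> = 1 - real DIM('a) / p"
  define D where "D = (\<kappa> * 32 ^ DIM('a) * 3 powr p) powr (1 / p)"
  define M where "M = morrey_const DIM('a) p \<kappa>"
  have g: "0 < \<gamma>" "\<gamma> < 1" using gamma by (auto simp: \<gamma>_def)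
  have q: "0 < (1/2::real) powr \<gamma>" "(1/2::real) powr \<gamma> < 1" using g powr_less_mono2[of \<gamma> "1/2" 1] by auto
  have D0: "D \<ge> 0" by (simp add: D_def)
  have M: "M * (1 - (1/2) powr \<gamma>) = 3 * D"
    unfolding M_def morrey_const_def D_def[symmetric] \<gamma>_def[symmetric] using q g by simp
  have M3: "3 * D \<le> M"
    unfolding M_def morrey_const_def D_def[symmetric] \<gamma>_def[symmetric]
    using q D0 by (simp add: pos_le_divide_eq algebra_simps)
  obtain k :: nat where "R / h < 2 ^ k" using real_arch_pow[of 2 "R / h"] by auto
  then have "R < 2 ^ k * h" using h by (simp add: field_simps)
  then have "\<bar>local_mean u - mean (ball u R)\<bar> \<le> M * R powr \<gamma>" using assms
  proof (induction k arbitrary: R)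
    \<comment> \<open>Vacuous, since R < h contradicts the assumption that h is at most R.\<close>
    case 0 then show ?case by simp
  next
    case (Suc k)
    have R: "R > 0" using h Suc by linarith
    have uV: "u \<in> V" using Suc R by auto
    show ?case
    proof (cases "R < 2 * h")
      case True
      have hV: "ball u h \<subseteq> V" using Suc by force
      \<comment> \<open>At the final scale every value of \<open>local_mean\<close> in
        \<open>ball u h\<close> is compared directly with the value at the centre. This costs one D,
        the passage from h to R < 2h costs 2 D, and 3 D is at most M.\<close>
      have "\<bar>local_mean u - mean (ball u h)\<bar> \<le> (\<kappa> * h powr (p - real DIM('a))) powr (1 / p)"
      proof (rule abs_diff_mean_le)
        fix v assume "v \<in> ball u h"
        then have "\<bar>local_mean v - local_mean u\<bar> powr p \<le> \<kappa> * h powr (p - real DIM('a))"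
          using hV uV by (intro local_mean_diff_le) (auto simp: dist_commute)
        then have "(\<bar>local_mean v - local_mean u\<bar> powr p) powr (1 / p) \<le> (\<kappa> * h powr (p - real DIM('a))) powr (1 / p)"
          using p1 by (intro powr_mono2) auto
        then show "\<bar>local_mean v - local_mean u\<bar> \<le> (\<kappa> * h powr (p - real DIM('a))) powr (1 / p)"
          using p1 by (simp add: powr_powr)
      qed (use h in \<open>auto simp: measure_def emeasure_ball\<close>)
      also have "\<dots> = \<kappa> powr (1 / p) * h powr \<gamma>"
        unfolding \<gamma>_def using \<kappa> h by (intro powr_gamma) auto
      also have "\<dots> \<le> D * R powr \<gamma>"
      proof (rule mult_mono)
        have "\<kappa> * 1 * 1 \<le> \<kappa> * 32 ^ DIM('a) * 3 powr p"
          using \<kappa> p1 by (intro mult_mono) (auto intro!: ge_one_powr_ge_zero)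
        then show "\<kappa> powr (1 / p) \<le> D" unfolding D_def using \<kappa> p1 by (intro powr_mono2) auto
        show "h powr \<gamma> \<le> R powr \<gamma>" using h Suc g by (intro powr_mono2) auto
      qed (auto simp: D0)
      finally have 1: "\<bar>local_mean u - mean (ball u h)\<bar> \<le> D * R powr \<gamma>" .
      have 2: "\<bar>mean (ball u h) - mean (ball u R)\<bar> \<le> 2 * D * R powr \<gamma>"
        unfolding D_def \<gamma>_def using Suc R True by (intro mean_balls[where c=u]) auto
      have "3 * D * R powr \<gamma> \<le> M * R powr \<gamma>" using M3 by (intro mult_right_mono) auto
      then show ?thesis using 1 2 by (simp add: algebra_simps)
    next
      case False
      have "ball u (R / 2) \<subseteq> ball u R" using R by (intro subset_ball) auto
      then have 1: "\<bar>local_mean u - mean (ball u (R / 2))\<bar> \<le> M * (R / 2) powr \<gamma>"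
        using Suc False by (intro Suc.IH) auto
      have 2: "\<bar>mean (ball u (R / 2)) - mean (ball u R)\<bar> \<le> 2 * D * R powr \<gamma>"
        unfolding D_def \<gamma>_def using Suc R by (intro mean_balls[where c=u]) auto
      have "M * (R / 2) powr \<gamma> = M * (1/2) powr \<gamma> * R powr \<gamma>"
        using R powr_mult[of "1/2" R \<gamma>] by simp
      also have "M * (1/2) powr \<gamma> = M - 3 * D" using M by (simp add: algebra_simps)
      finally have 3: "M * (R / 2) powr \<gamma> = M * R powr \<gamma> - 3 * (D * R powr \<gamma>)"
        by (simp add: algebra_simps)
      have 4: "D * R powr \<gamma> \<ge> 0" using D0 by simp
      have "2 * D * R powr \<gamma> = 2 * (D * R powr \<gamma>)" by simp
      then show ?thesis using 1 2 4 unfolding 3 by linarith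
    qed
  qed
  then show ?thesis by (simp add: M_def \<gamma>_def)
qed

text \<open>Both balls of radius R, at \<open>u\<close> and at \<open>v\<close>, lie in
  \<open>ball u (2 * R)\<close>. The constant 4 M collects M from each end and 2 D 2^\<gamma>, at
  most 4 D and hence at most 2 M, from comparing the two ball means, with \<gamma> = 1 -
  d/p.\<close>

lemma local_mean_holder:
  assumes uv: "dist u v \<le> R" and R: "h \<le> R" and V: "ball u (2 * R) \<subseteq> V"
  shows "\<bar>local_mean u - local_mean v\<bar> \<le> 4 * morrey_const DIM('a) p \<kappa> * R powr (1 - real DIM('a) / p)"
proof -
  define \<gamma> where "\<gamma> = 1 - real DIM('a) / p"
  define D where "D = (\<kappa> * 32 ^ DIM('a) * 3 powr p) powr (1 / p)"
  define M where "M = morrey_const DIM('a) p \<kappa>"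
  have g: "0 < \<gamma>" "\<gamma> < 1" using gamma by (auto simp: \<gamma>_def)
  have q: "0 < (1/2::real) powr \<gamma>" "(1/2::real) powr \<gamma> < 1" using g powr_less_mono2[of \<gamma> "1/2" 1] by auto
  have D0: "D \<ge> 0" by (simp add: D_def)
  have M3: "3 * D \<le> M"
    unfolding M_def morrey_const_def D_def[symmetric] \<gamma>_def[symmetric]
    using q D0 by (simp add: pos_le_divide_eq algebra_simps)
  have R0: "R > 0" using h R by linarith
  have s1: "ball u R \<subseteq> ball u (2 * R)" using R0 by (intro subset_ball) auto
  have s2: "ball v R \<subseteq> ball u (2 * R)" using uv by (intro ball_subset_ball_iff[THEN iffD2]) (auto simp: dist_commute)
  have "\<bar>local_mean u - mean (ball u R)\<bar> \<le> M * R powr \<gamma>" unfolding M_def \<gamma>_def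
    using s1 V R by (intro local_mean_ball_mean) auto
  moreover have "\<bar>local_mean v - mean (ball v R)\<bar> \<le> M * R powr \<gamma>" unfolding M_def \<gamma>_def
    using s2 V R by (intro local_mean_ball_mean) auto
  moreover have "\<bar>mean (ball u R) - mean (ball v R)\<bar> \<le> 2 * D * (2 * R) powr \<gamma>"
    unfolding D_def \<gamma>_def using s1 s2 V R R0 by (intro mean_balls[where c=u]) auto
  moreover have "2 * D * (2 * R) powr \<gamma> \<le> 2 * D * (2 * R powr \<gamma>)"
  proof -
    have "(2::real) powr \<gamma> \<le> 2 powr 1" using g by (intro powr_mono) auto
    then have "(2 * R) powr \<gamma> \<le> 2 * R powr \<gamma>" using R0 by (simp add: powr_mult mult_right_mono)
    then show ?thesis using D0 by (intro mult_left_mono) auto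
  qed
  moreover have "4 * D * R powr \<gamma> \<le> 2 * M * R powr \<gamma>" using M3 D0 by (intro mult_right_mono) auto
  ultimately have "\<bar>local_mean u - local_mean v\<bar> \<le> 4 * M * R powr \<gamma>" by (simp add: algebra_simps)
  then show ?thesis by (simp add: M_def \<gamma>_def)
qed

lemma phi_holder:
  assumes ij: "i \<in> I" "j \<in> I" "dist (X i) (X j) \<le> R" and R: "h \<le> R" and V: "ball (X i) (2 * R) \<subseteq> V"
  shows "\<bar>\<phi> i - \<phi> j\<bar> \<le> 4 * morrey_const DIM('a) p \<kappa> * R powr (1 - real DIM('a) / p)
           + 2 * (\<kappa> * h powr (p - real DIM('a)) * m) powr (1 / p)"
proof -
  have R0: "R > 0" using h R by linarith
  have *: "\<bar>\<phi> k - local_mean (X k)\<bar> \<le> (\<kappa> * h powr (p - real DIM('a)) * m) powr (1 / p)"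
    if "k \<in> I" "X k \<in> V" for k
  proof -
    have "\<bar>\<phi> k - local_mean (X k)\<bar> powr p \<le> \<kappa> * h powr (p - real DIM('a)) * m"
      using that h by (intro phi_local_mean_diff) auto
    then have "(\<bar>\<phi> k - local_mean (X k)\<bar> powr p) powr (1 / p) \<le> (\<kappa> * h powr (p - real DIM('a)) * m) powr (1 / p)"
      using p1 by (intro powr_mono2) auto
    then show ?thesis using p1 by (simp add: powr_powr)
  qed
  have "X i \<in> V" "X j \<in> V" using V R0 ij(3) by (auto intro!: subsetD[OF V])
  then show ?thesis
    using *[of i] *[of j] local_mean_holder[OF ij(3) R V] ij by linarith
qed

end

subsection \<open>Hoelder regularity up to a Lipschitz boundary\<close>

lemma norm_orthogonal_part_le:
  fixes v w :: "'a::euclidean_space"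
  assumes "norm v = 1"
  shows "norm (w - (w \<bullet> v) *\<^sub>R v) \<le> norm w"
proof -
  have vv: "v \<bullet> v = 1" using assms by (simp add: norm_eq_1)
  have "(norm (w - (w \<bullet> v) *\<^sub>R v))\<^sup>2 = (norm w)\<^sup>2 - (w \<bullet> v)\<^sup>2"
    unfolding power2_norm_eq_inner using vv
    by (simp add: inner_diff_left inner_diff_right inner_commute power2_eq_square)
  then have "(norm (w - (w \<bullet> v) *\<^sub>R v))\<^sup>2 \<le> (norm w)\<^sup>2" by simp
  then show ?thesis by (rule power2_le_imp_le) simp
qed

text \<open>Moving by t along \<open>v\<close> raises the height over the graph by t. A further
  displacement w changes the height by at most |w| and the graph function by at most L |w|, so the
  point stays above the graph as long as (1 + L) |w| < t. This gives the aperture 1 / (1 + L), with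
  the same direction \<open>v\<close> for all points near \<open>z\<close>. Quartering r keeps
  everything inside the chart.\<close>

lemma lipschitz_boundary_cone:
  fixes \<Omega> :: "'a::euclidean_space set"
  assumes "lipschitz_boundary \<Omega>" "z \<in> frontier \<Omega>"
  obtains r \<kappa> and v :: 'a where "r > 0" "0 < \<kappa>" "\<kappa> \<le> 1" "norm v = 1"
    "\<And>x t. x \<in> \<Omega> \<Longrightarrow> dist x z < r \<Longrightarrow> 0 < t \<Longrightarrow> t \<le> r \<Longrightarrow> ball (x + t *\<^sub>R v) (\<kappa> * t) \<subseteq> \<Omega>"
proof -
  obtain r v L g where r: "r > 0" and v: "norm v = 1"
    and lip: "L-lipschitz_on {h. h \<bullet> v = 0} (g :: 'a \<Rightarrow> real)"
    and eq: "\<Omega> \<inter> ball z r = {x \<in> ball z r. x \<bullet> v > g (x - (x \<bullet> v) *\<^sub>R v)}"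
    using assms unfolding lipschitz_boundary_def by meson
  have L: "L \<ge> 0" using lip by (rule lipschitz_on_nonneg)
  have vv: "v \<bullet> v = 1" using v by (simp add: norm_eq_1)
  define P where "P w = w - (w \<bullet> v) *\<^sub>R v" for w
  have P0: "P w \<bullet> v = 0" for w by (simp add: P_def inner_diff_left vv)
  have "ball (x + t *\<^sub>R v) (1 / (1 + L) * t) \<subseteq> \<Omega>"
    if x: "x \<in> \<Omega>" "dist x z < r / 4" and t: "0 < t" "t \<le> r / 4" for x t
  proof
    fix y assume y: "y \<in> ball (x + t *\<^sub>R v) (1 / (1 + L) * t)"
    define w where "w = y - (x + t *\<^sub>R v)"
    have w: "norm w < 1 / (1 + L) * t" using y by (simp add: w_def dist_norm norm_minus_commute)
    have w1: "(1 + L) * norm w < t" using w L by (simp add: field_simps)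
    have w2: "norm w < t"
      using w1 L by (smt (verit) mult_le_cancel_right1 norm_ge_zero)
    have yw: "y = x + t *\<^sub>R v + w" by (simp add: w_def)
    have "dist y z \<le> norm (t *\<^sub>R v + w) + dist x z"
      using dist_triangle[of y z x] by (simp add: yw dist_norm)
    also have "norm (t *\<^sub>R v + w) \<le> t + norm w"
      using norm_triangle_ineq[of "t *\<^sub>R v" w] t v by simp
    finally have yz: "dist y z < r" using w2 t x by linarith
    have Py: "P y = P x + P w"
      by (simp add: yw P_def inner_add_left vv algebra_simps)
    have "\<bar>g (P y) - g (P x)\<bar> \<le> L * norm (P w)"
      using lipschitz_onD[OF lip, of "P y" "P x"] P0[of y] P0[of x] by (simp add: dist_norm Py)
    also have "\<dots> \<le> L * norm w"
      using norm_orthogonal_part_le[OF v, of w] L by (intro mult_left_mono) (auto simp: P_def)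
    finally have 1: "g (P y) \<le> g (P x) + L * norm w" by linarith
    have "x \<in> \<Omega> \<inter> ball z r" using x r by (auto simp: dist_commute)
    then have 2: "g (P x) < x \<bullet> v" unfolding eq P_def by auto
    have 3: "y \<bullet> v = x \<bullet> v + t + w \<bullet> v" by (simp add: yw inner_add_left vv)
    have 4: "\<bar>w \<bullet> v\<bar> \<le> norm w" using Cauchy_Schwarz_ineq2[of w v] v by simp
    have "g (P y) < y \<bullet> v" using 1 2 3 4 w1 by (simp add: algebra_simps)
    then have "y \<in> \<Omega> \<inter> ball z r" unfolding eq using yz by (auto simp: P_def dist_commute)
    then show "y \<in> \<Omega>" by simp
  qed
  then show ?thesis
    using r v L by (intro that[of "r / 4" "1 / (1 + L)" v]) auto
qed

text \<open>
  Two points at distance \<rho> are first moved along the cone direction by T, proportional to \<rho>, where a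
  common ball fits into \<Omega>; the way back uses the steps T q^k, whose oscillations sum geometrically.
\<close>
lemma cone_imp_local_holder:
  fixes g :: "'a::euclidean_space \<Rightarrow> real"
  assumes osc: "\<And>c R u v. R > 0 \<Longrightarrow> ball c (a * R) \<subseteq> \<Omega> \<Longrightarrow> u \<in> ball c R \<Longrightarrow> v \<in> ball c R
        \<Longrightarrow> \<bar>g u - g v\<bar> \<le> C * R powr \<gamma>"
    and a: "a \<ge> 1" and \<gamma>: "\<gamma> > 0" and C: "C \<ge> 0"
    and op: "open \<Omega>" and cont: "continuous_on \<Omega> g"
    and r: "r > 0" and \<kappa>: "0 < \<kappa>" "\<kappa> \<le> 1" and v: "norm v = 1"
    and cone: "\<And>x t. x \<in> \<Omega> \<Longrightarrow> dist x z < r \<Longrightarrow> 0 < t \<Longrightarrow> t \<le> r \<Longrightarrow> ball (x + t *\<^sub>R v) (\<kappa> * t) \<subseteq> \<Omega>"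
  shows "\<exists>r'>0. \<exists>C'\<ge>0. \<forall>x\<in>\<Omega> \<inter> ball z r'. \<forall>y\<in>\<Omega> \<inter> ball z r'. \<bar>g x - g y\<bar> \<le> C' * dist x y powr \<gamma>"
proof -
  \<comment> \<open>The step from height t to t q has length \<kappa> t / (2 a), half the radius
    \<kappa> t / a of a ball whose a-fold dilation is exactly the one supplied by
    \<open>cone\<close>.\<close>
  define q where "q = 1 - \<kappa> / (2 * a)"
  have q: "1/2 \<le> q" "q < 1" using \<kappa> a by (auto simp: q_def field_simps)
  define Q where "Q = q powr \<gamma>"
  have Q: "0 < Q" "Q < 1" using q \<gamma> powr_less_mono2[of \<gamma> q 1] by (auto simp: Q_def)
  \<comment> \<open>Two points of \<open>ball z r'\<close> have distance below 2 r', which makes the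
    height T = 2 a \<rho> / \<kappa> used below at most r.\<close>
  define r' where "r' = \<kappa> * r / (4 * a)"
  have r'0: "r' > 0" using \<kappa> r a by (simp add: r'_def)
  have r'r: "r' \<le> r"
  proof -
    have "\<kappa> * r \<le> (4 * a) * r" using \<kappa> a r by (intro mult_right_mono) auto
    then show ?thesis using a by (simp add: r'_def field_simps)
  qed
  \<comment> \<open>The summand 1 is the comparison inside the common ball and 2 / (1 - Q) the two
    descents; the factor \<open>2 powr \<gamma>\<close> comes from working with radius 2
    \<rho>.\<close>
  define C' where "C' = C * 2 powr \<gamma> * (2 / (1 - Q) + 1)"
  have C'0: "C' \<ge> 0" using C Q by (simp add: C'_def)
  have descent: "\<bar>g (x + T *\<^sub>R v) - g x\<bar> \<le> C * (\<kappa> * T / a) powr \<gamma> / (1 - Q)"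
    if x: "x \<in> \<Omega>" "dist x z < r" and T: "0 < T" "T \<le> r" for x T
  proof -
    define S where "S = C * (\<kappa> * T / a) powr \<gamma> / (1 - Q)"
    have S0: "S \<ge> 0" using C Q by (simp add: S_def)
    have partial: "\<bar>g (x + T *\<^sub>R v) - g (x + (T * q ^ n) *\<^sub>R v)\<bar> \<le> S * (1 - Q ^ n)" for n
    proof (induction n)
      case 0 then show ?case by simp
    next
      case (Suc n)
      define t where "t = T * q ^ n"
      have t: "0 < t" "t \<le> r"
      proof -
        have "T * q ^ n \<le> T * 1" using q T by (intro mult_left_mono power_le_one) auto
        then show "t \<le> r" using T(2) unfolding t_def by linarith
      qed (use T q in \<open>simp add: t_def\<close>)
      have d: "dist (x + t *\<^sub>R v) (x + (t * q) *\<^sub>R v) = t * \<kappa> / (2 * a)"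
      proof -
        have "dist (x + t *\<^sub>R v) (x + (t * q) *\<^sub>R v) = norm ((t * (1 - q)) *\<^sub>R v)"
          by (simp add: dist_norm algebra_simps)
        also have "\<dots> = t * (1 - q)" using v t q by simp
        finally show ?thesis by (simp add: q_def)
      qed
      have "\<bar>g (x + t *\<^sub>R v) - g (x + (t * q) *\<^sub>R v)\<bar> \<le> C * (\<kappa> * t / a) powr \<gamma>"
      proof (rule osc)
        show "ball (x + t *\<^sub>R v) (a * (\<kappa> * t / a)) \<subseteq> \<Omega>" using cone[OF x t] a by simp
        show "x + (t * q) *\<^sub>R v \<in> ball (x + t *\<^sub>R v) (\<kappa> * t / a)"
        proof -
          have "t * \<kappa> / (2 * a) < \<kappa> * t / a" using t \<kappa> a by (simp add: field_simps)
          then show ?thesis using d by simp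
        qed
      qed (use t \<kappa> a in auto)
      also have "C * (\<kappa> * t / a) powr \<gamma> = S * (1 - Q) * Q ^ n"
      proof -
        have "\<kappa> * t / a = \<kappa> * T / a * q ^ n" by (simp add: t_def)
        then have "(\<kappa> * t / a) powr \<gamma> = (\<kappa> * T / a * q ^ n) powr \<gamma>" by (rule arg_cong)
        also have "\<dots> = (\<kappa> * T / a) powr \<gamma> * (q ^ n) powr \<gamma>"
          using \<kappa> T a q by (intro powr_mult)
        also have "(q ^ n) powr \<gamma> = Q ^ n"
          using q unfolding Q_def by (induction n) (simp_all add: powr_mult)
        finally show ?thesis using Q by (simp add: S_def)
      qed
      finally show ?case using Suc by (simp add: t_def algebra_simps)
    qed
    \<comment> \<open>The points reached approach \<open>x\<close> but never arrive, so continuity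
      of \<open>g\<close> at \<open>x\<close> closes the descent.\<close>
    have "(\<lambda>n. x + (T * q ^ n) *\<^sub>R v) \<longlonglongrightarrow> x + (T * 0) *\<^sub>R v"
      using q by (intro tendsto_intros LIMSEQ_power_zero) auto
    then have lim: "(\<lambda>n. x + (T * q ^ n) *\<^sub>R v) \<longlonglongrightarrow> x" by simp
    have "isCont g x" using cont op x by (simp add: continuous_on_eq_continuous_at)
    then have "(\<lambda>n. g (x + (T * q ^ n) *\<^sub>R v)) \<longlonglongrightarrow> g x"
      using lim by (rule isCont_tendsto_compose)
    then have "(\<lambda>n. \<bar>g (x + T *\<^sub>R v) - g (x + (T * q ^ n) *\<^sub>R v)\<bar>) \<longlonglongrightarrow> \<bar>g (x + T *\<^sub>R v) - g x\<bar>"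
      by (intro tendsto_intros)
    moreover have "\<bar>g (x + T *\<^sub>R v) - g (x + (T * q ^ n) *\<^sub>R v)\<bar> \<le> S" for n
    proof -
      have "S * (1 - Q ^ n) \<le> S * 1" using S0 Q by (intro mult_left_mono) auto
      then show ?thesis using partial[of n] by simp
    qed
    ultimately show ?thesis unfolding S_def[symmetric] by (intro LIMSEQ_le_const2) auto
  qed
  have "\<bar>g x - g y\<bar> \<le> C' * dist x y powr \<gamma>" if "x \<in> \<Omega> \<inter> ball z r'" "y \<in> \<Omega> \<inter> ball z r'" for x y
  proof (cases "x = y")
    case False
    define \<rho> where "\<rho> = dist x y"
    have \<rho>: "\<rho> > 0" "\<rho> < 2 * r'"
      using False that dist_triangle[of x y z] by (auto simp: \<rho>_def dist_commute)
    \<comment> \<open>At this height the ball supplied by \<open>cone\<close> at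
      \<open>x + T *\<^sub>R v\<close> has radius a (2 \<rho>), so \<open>osc\<close> applies with
      radius 2 \<rho>, and the shifted \<open>y\<close> lies in that smaller ball.\<close>
    define T where "T = 2 * a * \<rho> / \<kappa>"
    have T: "0 < T" "T \<le> r"
    proof -
      have "2 * a * \<rho> \<le> 2 * a * (2 * r')" using \<rho> a by (intro mult_left_mono) auto
      also have "\<dots> = \<kappa> * r" using a by (simp add: r'_def)
      finally show "T \<le> r" using \<kappa> by (simp add: T_def field_simps)
    qed (use \<rho> a \<kappa> in \<open>simp add: T_def\<close>)
    have kT: "\<kappa> * T / a = 2 * \<rho>" "\<kappa> * T = a * (2 * \<rho>)" using \<kappa> a by (auto simp: T_def)
    have xy: "x \<in> \<Omega>" "dist x z < r" "y \<in> \<Omega>" "dist y z < r" using that r'r by (auto simp: dist_commute)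
    have "\<bar>g (x + T *\<^sub>R v) - g (y + T *\<^sub>R v)\<bar> \<le> C * (2 * \<rho>) powr \<gamma>"
    proof (rule osc)
      show "ball (x + T *\<^sub>R v) (a * (2 * \<rho>)) \<subseteq> \<Omega>" using cone[OF xy(1,2) T] by (simp add: kT(2))
    qed (use \<rho> in \<open>auto simp: \<rho>_def\<close>)
    moreover note descent[OF xy(1,2) T, unfolded kT(1)] descent[OF xy(3,4) T, unfolded kT(1)]
    ultimately have "\<bar>g x - g y\<bar> \<le> C * (2 * \<rho>) powr \<gamma> + 2 * (C * (2 * \<rho>) powr \<gamma> / (1 - Q))"
      by linarith
    also have "\<dots> = C' * \<rho> powr \<gamma>"
      using \<rho> Q by (simp add: C'_def powr_mult algebra_simps)
    finally show ?thesis by (simp add: \<rho>_def)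
  qed simp
  with r'0 C'0 show ?thesis by blast
qed

text \<open>Local estimates near interior points come from \<open>osc\<close> alone, those near
  boundary points from the cone. Compactness of the closure yields a finite subcover and a Lebesgue
  number \<delta>: pairs closer than \<delta> share a chart, and for the others boundedness of
  \<open>g\<close> is enough.\<close>

lemma interior_oscillation_imp_holder:
  fixes g :: "'a::euclidean_space \<Rightarrow> real"
  assumes osc: "\<And>c R u v. R > 0 \<Longrightarrow> ball c (a * R) \<subseteq> \<Omega> \<Longrightarrow> u \<in> ball c R \<Longrightarrow> v \<in> ball c R
        \<Longrightarrow> \<bar>g u - g v\<bar> \<le> C * R powr \<gamma>"
    and a: "a \<ge> 1" and \<gamma>: "\<gamma> > 0" and C: "C \<ge> 0"
    and op: "open \<Omega>" and cont: "continuous_on \<Omega> g"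
    and bd: "bounded \<Omega>" and lip: "lipschitz_boundary \<Omega>"
  shows "g \<in> holder_space \<gamma> \<Omega>"
proof -
  have "\<exists>r>0. \<exists>C'\<ge>0. \<forall>x\<in>\<Omega> \<inter> ball z r. \<forall>y\<in>\<Omega> \<inter> ball z r. \<bar>g x - g y\<bar> \<le> C' * dist x y powr \<gamma>"
    if z: "z \<in> closure \<Omega>" for z
  proof (cases "z \<in> \<Omega>")
    case False
    then have "z \<in> frontier \<Omega>" using z op by (simp add: frontier_def interior_open)
    then obtain r \<kappa> and v :: 'a where "r > 0" "0 < \<kappa>" "\<kappa> \<le> 1" "norm v = 1"
      "\<And>x t. x \<in> \<Omega> \<Longrightarrow> dist x z < r \<Longrightarrow> 0 < t \<Longrightarrow> t \<le> r \<Longrightarrow> ball (x + t *\<^sub>R v) (\<kappa> * t) \<subseteq> \<Omega>"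
      using lipschitz_boundary_cone[OF lip] by blast
    then show ?thesis by (intro cone_imp_local_holder[OF osc a \<gamma> C op cont])
  next
    case True
    then obtain r0 where r0: "r0 > 0" "ball z r0 \<subseteq> \<Omega>" using op open_contains_ball by blast
    \<comment> \<open>The ball around \<open>x\<close> has radius 2 a \<rho>, below 4 a r, and
      \<open>x\<close> is within r of \<open>z\<close>; the sum is at most 5 a r, which is
      r0.\<close>
    define r where "r = r0 / (5 * a)"
    have r: "r > 0" using r0 a by (simp add: r_def)
    have "\<bar>g x - g y\<bar> \<le> C * 2 powr \<gamma> * dist x y powr \<gamma>"
      if xy: "x \<in> \<Omega> \<inter> ball z r" "y \<in> \<Omega> \<inter> ball z r" for x y
    proof (cases "x = y")
      case False
      define \<rho> where "\<rho> = dist x y"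
      have \<rho>: "\<rho> > 0" "\<rho> < 2 * r"
        using False xy dist_triangle[of x y z] by (auto simp: \<rho>_def dist_commute)
      have "\<bar>g x - g y\<bar> \<le> C * (2 * \<rho>) powr \<gamma>"
      proof (rule osc)
        have "a * (2 * \<rho>) \<le> a * (4 * r)" using \<rho> a by (intro mult_left_mono) auto
        moreover have "r \<le> a * r" using a r by simp
        moreover have "5 * (a * r) = r0" using a by (simp add: r_def)
        ultimately have "dist z x + a * (2 * \<rho>) \<le> r0" using xy by (simp add: algebra_simps)
        then have "ball x (a * (2 * \<rho>)) \<subseteq> ball z r0"
          by (intro ball_subset_ball_iff[THEN iffD2]) (auto simp: dist_commute)
        then show "ball x (a * (2 * \<rho>)) \<subseteq> \<Omega>" using r0 by blast
      qed (use \<rho> in \<open>auto simp: \<rho>_def\<close>)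
      then show ?thesis using \<rho> by (simp add: \<rho>_def powr_mult mult_ac)
    qed simp
    moreover have "C * 2 powr \<gamma> \<ge> 0" using C by simp
    ultimately show ?thesis using r by blast
  qed
  then obtain r C' where rC: "\<And>z. z \<in> closure \<Omega> \<Longrightarrow> r z > 0" "\<And>z. z \<in> closure \<Omega> \<Longrightarrow> C' z \<ge> 0"
    "\<And>z x y. z \<in> closure \<Omega> \<Longrightarrow> x \<in> \<Omega> \<inter> ball z (r z) \<Longrightarrow> y \<in> \<Omega> \<inter> ball z (r z)
        \<Longrightarrow> \<bar>g x - g y\<bar> \<le> C' z * dist x y powr \<gamma>"
    by metis
  have "compact (closure \<Omega>)" using bd by (simp add: compact_closure)
  then obtain Z where Z: "Z \<subseteq> closure \<Omega>" "finite Z" "closure \<Omega> \<subseteq> (\<Union>z\<in>Z. ball z (r z / 2))"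
    by (rule compactE_image[where f="\<lambda>z. ball z (r z / 2)"]) (use rC(1) in force)+
  have cover: "\<exists>z\<in>Z. x \<in> ball z (r z / 2)" if "x \<in> \<Omega>" for x
    using Z(3) that closure_subset by fastforce
  have bdg: "bounded (g ` \<Omega>)"
  proof -
    have "bounded (\<Union>z\<in>Z. g ` (\<Omega> \<inter> ball z (r z)))"
    proof (intro bounded_UN ballI Z(2))
      fix z assume "z \<in> Z"
      then have z: "z \<in> closure \<Omega>" using Z by blast
      show "bounded (g ` (\<Omega> \<inter> ball z (r z)))"
      proof (cases "\<Omega> \<inter> ball z (r z) = {}")
        case False
        then obtain x where x: "x \<in> \<Omega> \<inter> ball z (r z)" by blast
        have "dist (g x) (g y) \<le> C' z * (2 * r z) powr \<gamma>" if y: "y \<in> \<Omega> \<inter> ball z (r z)" for y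
        proof -
          have "dist x y \<le> 2 * r z" using x y dist_triangle[of x y z] by (auto simp: dist_commute)
          then have "C' z * dist x y powr \<gamma> \<le> C' z * (2 * r z) powr \<gamma>"
            using rC(2)[OF z] \<gamma> by (intro mult_left_mono powr_mono2) auto
          then show ?thesis using rC(3)[OF z x y] by (simp add: dist_real_def)
        qed
        then show ?thesis by (intro bounded_any_center[where a="g x", THEN iffD2]) blast
      qed simp
    qed
    moreover have "g ` \<Omega> \<subseteq> (\<Union>z\<in>Z. g ` (\<Omega> \<inter> ball z (r z)))"
    proof
      fix t assume "t \<in> g ` \<Omega>"
      then obtain x where x: "x \<in> \<Omega>" "t = g x" by blast
      obtain z where "z \<in> Z" "x \<in> ball z (r z / 2)" using cover x by blast
      moreover from this have "r z > 0" using rC(1) Z by blast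
      ultimately have "x \<in> \<Omega> \<inter> ball z (r z)" using x by auto
      then show "t \<in> (\<Union>z\<in>Z. g ` (\<Omega> \<inter> ball z (r z)))" using x \<open>z \<in> Z\<close> by blast
    qed
    ultimately show ?thesis by (rule bounded_subset)
  qed
  then obtain B where B: "\<And>x. x \<in> \<Omega> \<Longrightarrow> \<bar>g x\<bar> \<le> B" by (auto simp: bounded_iff)
  \<comment> \<open>The cover uses half radii, so a point within \<delta> of a point in a half ball
    is still in the full ball. The entry 1 keeps the minimum defined if Z is empty.\<close>
  define \<delta> where "\<delta> = Min (insert 1 ((\<lambda>z. r z / 2) ` Z))"
  have \<delta>: "\<delta> > 0" using Z rC(1) by (auto simp: \<delta>_def subset_iff)
  have \<delta>r: "\<delta> \<le> r z / 2" if "z \<in> Z" for z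
    unfolding \<delta>_def using Z that by (intro Min_le) auto
  \<comment> \<open>The extra entry handles pairs at distance at least \<delta>. The absolute value
    is there because an empty \<Omega> leaves the sign of \<open>B\<close> open.\<close>
  define H where "H = Max (insert (2 * \<bar>B\<bar> / \<delta> powr \<gamma>) (C' ` Z))"
  have H: "\<And>z. z \<in> Z \<Longrightarrow> C' z \<le> H" "2 * \<bar>B\<bar> / \<delta> powr \<gamma> \<le> H" using Z by (auto simp: H_def)
  have "\<bar>g x - g y\<bar> \<le> H * dist x y powr \<gamma>" if xy: "x \<in> \<Omega>" "y \<in> \<Omega>" for x y
  proof (cases "dist x y < \<delta>")
    case True
    obtain z where z: "z \<in> Z" "x \<in> ball z (r z / 2)" using cover xy by blast
    have rz: "r z > 0" using rC(1) Z z by blast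
    have "dist z y < r z" using z True \<delta>r[OF z(1)] dist_triangle[of z y x] by simp
    then have "\<bar>g x - g y\<bar> \<le> C' z * dist x y powr \<gamma>"
      using z xy Z rz by (intro rC(3)) auto
    also have "\<dots> \<le> H * dist x y powr \<gamma>" using H z by (intro mult_right_mono) auto
    finally show ?thesis .
  next
    case False
    have "\<bar>g x - g y\<bar> \<le> 2 * \<bar>B\<bar>" using B[OF xy(1)] B[OF xy(2)] by linarith
    also have "\<dots> = 2 * \<bar>B\<bar> / \<delta> powr \<gamma> * \<delta> powr \<gamma>" using \<delta> by simp
    also have "\<dots> \<le> H * dist x y powr \<gamma>"
      using H(2) False \<delta> \<gamma> by (intro mult_mono powr_mono2 order_trans[OF _ H(2)]) auto
    finally show ?thesis .
  qed
  then show ?thesis using bdg by (auto simp: holder_space_def)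
qed

subsection \<open>Passing to the limit along couplings\<close>

text \<open>Markov's inequality for a coupling: if every sample point failed against every point of
  A, the pairs with second component in A alone would cost at least t^p times the measure of A. The
  threshold on n depends on \<alpha> and t but not on A, so A may later be a ball that moves with
  n.\<close>

lemma tlp_converges_selection:
  fixes X :: "nat \<Rightarrow> 'a::euclidean_space" and f :: "'a \<Rightarrow> real"
  assumes conv: "tlp_converges p \<Omega>
           (\<lambda>n. (empirical_measure X n, extend_by_zero (sample_points X n) (\<phi> n))) (\<mu>, f)"
    and p: "p > 0" and prob: "prob_space \<mu>" and \<alpha>: "\<alpha> > 0" and t: "t > 0"
  shows "\<forall>\<^sub>F n in sequentially. \<forall>A\<in>sets borel. measure \<mu> A \<ge> \<alpha> \<longrightarrow>
           (\<exists>i\<in>{1..n}. \<exists>y\<in>A. dist (X i) y < t \<and> \<bar>\<phi> n (X i) - f y\<bar> < t)"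
proof -
  interpret prob_space \<mu> by (rule prob)
  let ?S = "\<lambda>n. (empirical_measure X n, extend_by_zero (sample_points X n) (\<phi> n))"
  define \<beta> where "\<beta> = t powr p * \<alpha>"
  have \<beta>: "\<beta> > 0" using t \<alpha> by (simp add: \<beta>_def)
  have "(\<lambda>n. tlp_dist p (?S n) (\<mu>, f)) \<longlonglongrightarrow> 0" using conv by (simp add: tlp_converges_def)
  then have "\<forall>\<^sub>F n in sequentially. tlp_dist p (?S n) (\<mu>, f) < ennreal (\<beta> powr (1 / p))"
    using \<beta> by (intro order_tendstoD(2)) auto
  then show ?thesis
  proof eventually_elim
    case (elim n)
    have fin: "tlp_cost p (?S n) (\<mu>, f) \<noteq> \<top>"
      using elim by (auto simp: tlp_dist_def)
    then have "enn2real (tlp_cost p (?S n) (\<mu>, f)) powr (1 / p) < \<beta> powr (1 / p)"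
      using elim by (simp add: tlp_dist_def ennreal_less_iff)
    then have "enn2real (tlp_cost p (?S n) (\<mu>, f)) < \<beta>"
      using p \<beta> by (smt (verit) powr_mono2 enn2real_nonneg divide_nonneg_nonneg)
    then have "tlp_cost p (?S n) (\<mu>, f) < ennreal \<beta>"
      using fin by (metis ennreal_enn2real ennreal_less_iff enn2real_nonneg less_top)
    then obtain \<pi> where \<pi>: "\<pi> \<in> couplings (empirical_measure X n) \<mu>"
      and lt: "(\<integral>\<^sup>+ z. ennreal (norm (fst z - snd z) powr p
          + \<bar>extend_by_zero (sample_points X n) (\<phi> n) (fst z) - f (snd z)\<bar> powr p) \<partial>\<pi>) < ennreal \<beta>"
      unfolding tlp_cost_def by (auto simp: INF_less_iff)
    have sets: "sets \<pi> = sets borel" and d1: "distr \<pi> borel fst = empirical_measure X n"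
      and d2: "distr \<pi> borel snd = \<mu>" using \<pi> by (auto simp: couplings_def)
    have space: "space \<pi> = UNIV" using sets_eq_imp_space_eq[OF sets] by simp
    have m1: "fst \<in> measurable \<pi> borel" and m2: "snd \<in> measurable \<pi> borel"
      unfolding measurable_cong_sets[OF sets refl]
      by (intro borel_measurable_continuous_onI continuous_intros)+
    show ?case
    proof (intro ballI impI, rule ccontr)
      fix A :: "'a set" assume A: "A \<in> sets borel" "\<alpha> \<le> measure \<mu> A"
        and no: "\<not> (\<exists>i\<in>{1..n}. \<exists>y\<in>A. dist (X i) y < t \<and> \<bar>\<phi> n (X i) - f y\<bar> < t)"
      let ?S = "sample_points X n"
      have S: "- ?S \<in> sets borel" by (intro borel_open open_Compl finite_imp_closed) (simp add: sample_points_def)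
      have "emeasure \<pi> (fst -` (- ?S)) = emeasure (empirical_measure X n) (- ?S)"
        unfolding d1[symmetric] using S by (subst emeasure_distr[OF m1]) (simp_all add: space)
      also have "\<dots> = emeasure (uniform_count_measure {1..n}) (X -` (- ?S) \<inter> {1..n})"
        unfolding empirical_measure_def using S
        by (subst emeasure_distr)
           (auto simp: measurable_def sets_uniform_count_measure space_uniform_count_measure)
      also have "X -` (- ?S) \<inter> {1..n} = {}" by (auto simp: sample_points_def)
      \<comment> \<open>Almost every first component is a sample point, so the value given by
        \<open>extend_by_zero\<close> elsewhere does not matter.\<close>
      finally have null: "fst -` (- ?S) \<in> null_sets \<pi>"
        using measurable_sets[OF m1 S] by (simp add: null_sets_def space)
      have sA: "snd -` A \<in> sets \<pi>" using measurable_sets[OF m2 A(1)] by (simp add: space)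
      have "ennreal \<alpha> \<le> emeasure \<mu> A"
        using A by (simp add: emeasure_eq_measure ennreal_leI)
      also have "\<dots> = emeasure \<pi> (snd -` A)"
        unfolding d2[symmetric] using A(1) by (subst emeasure_distr[OF m2]) (simp_all add: space)
      also have "\<dots> = emeasure \<pi> (snd -` A - fst -` (- ?S))"
        using null sA by (simp add: emeasure_Diff_null_set)
      finally have "ennreal (t powr p) * ennreal \<alpha> \<le> ennreal (t powr p) * emeasure \<pi> (snd -` A - fst -` (- ?S))"
        by (intro mult_left_mono) auto
      also have "\<dots> = (\<integral>\<^sup>+ z. ennreal (t powr p) * indicator (snd -` A - fst -` (- ?S)) z \<partial>\<pi>)"
        using sA null by (intro nn_integral_cmult_indicator[symmetric]) auto
      also have "\<dots> \<le> (\<integral>\<^sup>+ z. ennreal (norm (fst z - snd z) powr p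
          + \<bar>extend_by_zero ?S (\<phi> n) (fst z) - f (snd z)\<bar> powr p) \<partial>\<pi>)"
      proof (rule nn_integral_mono)
        fix z
        have "t powr p \<le> norm (fst z - snd z) powr p + \<bar>extend_by_zero ?S (\<phi> n) (fst z) - f (snd z)\<bar> powr p"
          if z: "snd z \<in> A" "fst z \<in> ?S"
        proof -
          obtain i where i: "i \<in> {1..n}" "fst z = X i" using z by (auto simp: sample_points_def)
          have "\<not> (dist (X i) (snd z) < t \<and> \<bar>\<phi> n (X i) - f (snd z)\<bar> < t)" using no i z by blast
          then have "t \<le> norm (fst z - snd z) \<or> t \<le> \<bar>extend_by_zero ?S (\<phi> n) (fst z) - f (snd z)\<bar>"
            using i z by (auto simp: extend_by_zero_def dist_norm)
          then have "t powr p \<le> norm (fst z - snd z) powr p \<or>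
             t powr p \<le> \<bar>extend_by_zero ?S (\<phi> n) (fst z) - f (snd z)\<bar> powr p"
            using t p by (auto intro!: powr_mono2)
          then show ?thesis by (smt (verit) powr_ge_zero)
        qed
        then show "ennreal (t powr p) * indicator (snd -` A - fst -` (- ?S)) z
          \<le> ennreal (norm (fst z - snd z) powr p + \<bar>extend_by_zero ?S (\<phi> n) (fst z) - f (snd z)\<bar> powr p)"
          by (auto simp: indicator_def simp del: ennreal_plus intro!: ennreal_leI)
      qed
      also note lt
      finally show False using \<alpha> by (simp add: \<beta>_def ennreal_mult')
    qed
  qed
qed

lemma oscillation_imp_continuous:
  fixes g :: "'a::euclidean_space \<Rightarrow> real"
  assumes osc: "\<And>c R u v. R > 0 \<Longrightarrow> ball c (a * R) \<subseteq> \<Omega> \<Longrightarrow> u \<in> ball c R \<Longrightarrow> v \<in> ball c R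
        \<Longrightarrow> \<bar>g u - g v\<bar> \<le> C * R powr \<gamma>"
    and a: "a \<ge> 1" and \<gamma>: "\<gamma> > 0" and op: "open \<Omega>"
  shows "continuous_on \<Omega> g"
proof -
  have "isCont g x" if x: "x \<in> \<Omega>" for x
  proof -
    obtain r0 where r0: "r0 > 0" "ball x r0 \<subseteq> \<Omega>" using op x open_contains_ball by blast
    have "((\<lambda>R. C * R powr \<gamma>) \<longlongrightarrow> C * 0 powr \<gamma>) (at_right 0)"
      using \<gamma> by (intro tendsto_intros) (auto simp: eventually_at_filter)
    then have lim: "((\<lambda>R. C * R powr \<gamma>) \<longlongrightarrow> 0) (at_right 0)" by simp
    show ?thesis
    proof (unfold isCont_def tendsto_iff, intro allI impI)
      fix e :: real assume e: "e > 0"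
      have "\<forall>\<^sub>F R in at_right 0. C * R powr \<gamma> < e"
        using lim e by (rule order_tendstoD(2))
      moreover have "\<forall>\<^sub>F R in at_right 0. R \<in> {0<..<r0 / a}"
        using r0 a by (intro eventually_at_right_real) auto
      ultimately have "\<forall>\<^sub>F R in at_right 0. C * R powr \<gamma> < e \<and> R \<in> {0<..<r0 / a}"
        by (rule eventually_conj)
      then obtain R where R: "C * R powr \<gamma> < e" "0 < R" "R < r0 / a"
        using eventually_happens'[OF trivial_limit_at_right_real] by auto
      have "a * R \<le> r0" using R a by (simp add: field_simps)
      then have sub: "ball x (a * R) \<subseteq> \<Omega>" using r0 subset_ball by blast
      have "\<forall>\<^sub>F y in at x. y \<in> ball x R"
        using R by (auto simp: eventually_at dist_commute intro!: exI[of _ R])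
      then show "\<forall>\<^sub>F y in at x. dist (g y) (g x) < e"
      proof eventually_elim
        case (elim y)
        then show ?case using osc[OF R(2) sub elim, of x] R by (simp add: dist_real_def)
      qed
    qed
  qed
  then show ?thesis using op by (simp add: continuous_on_eq_continuous_at)
qed

text \<open>
  The extension at x is squeezed by the intervals [L k, L k + M k], with L k the infimum of f over the
  k-th ball; these intervals meet pairwise for balls containing x because G is dense.
\<close>
lemma dense_extension:
  fixes f :: "'a::euclidean_space \<Rightarrow> real" and c :: "'j \<Rightarrow> 'a"
  assumes dense: "\<And>x r. r > 0 \<Longrightarrow> ball x r \<subseteq> \<Omega> \<Longrightarrow> ball x r \<inter> G \<noteq> {}"
    and sub: "\<And>k. k \<in> J \<Longrightarrow> ball (c k) (R k) \<subseteq> \<Omega>"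
    and osc: "\<And>k u v. k \<in> J \<Longrightarrow> u \<in> G \<inter> ball (c k) (R k) \<Longrightarrow> v \<in> G \<inter> ball (c k) (R k) \<Longrightarrow> f u - f v \<le> M k"
  obtains g where "\<And>k u v. k \<in> J \<Longrightarrow> u \<in> ball (c k) (R k) \<Longrightarrow> v \<in> ball (c k) (R k) \<Longrightarrow> \<bar>g u - g v\<bar> \<le> M k"
    "\<And>k u. k \<in> J \<Longrightarrow> u \<in> G \<inter> ball (c k) (R k) \<Longrightarrow> \<bar>g u - f u\<bar> \<le> M k"
proof -
  define B where "B k = ball (c k) (R k)" for k
  \<comment> \<open>Infima and suprema over empty sets do no harm: the estimates concern only points
    of some ball with index in \<open>J\<close>, and such a ball meets G by
    \<open>meet\<close>.\<close>
  define L where "L k = Inf (f ` (G \<inter> B k))" for k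
  define g where "g x = Sup (L ` {k\<in>J. x \<in> B k})" for x
  have meet: "\<exists>w. w \<in> G \<inter> B k \<inter> B l" if "k \<in> J" "x \<in> B k" "x \<in> B l" for k l x
  proof -
    have "open (B k \<inter> B l)" "x \<in> B k \<inter> B l" using that by (auto simp: B_def)
    then obtain r where r: "r > 0" "ball x r \<subseteq> B k \<inter> B l" by (rule openE)
    then have "ball x r \<inter> G \<noteq> {}" using sub[OF that(1)] by (intro dense) (auto simp: B_def)
    then show ?thesis using r by blast
  qed
  have bdd: "bdd_below (f ` (G \<inter> B k))" if k: "k \<in> J" for k
  proof (cases "G \<inter> B k = {}")
    case False
    then obtain w where w: "w \<in> G \<inter> B k" by blast
    show ?thesis
    proof (rule bdd_belowI2)
      fix v assume "v \<in> G \<inter> B k"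
      then show "f w - M k \<le> f v" using osc[OF k, of w v] w by (auto simp: B_def)
    qed
  qed simp
  have L1: "L k \<le> f w" if "k \<in> J" "w \<in> G \<inter> B k" for k w
    unfolding L_def using that bdd by (intro cINF_lower) auto
  have L2: "f w \<le> L k + M k" if "k \<in> J" "w \<in> G \<inter> B k" for k w
  proof -
    have "f w - M k \<le> L k" unfolding L_def
    proof (rule cINF_greatest)
      fix v assume "v \<in> G \<inter> B k"
      then show "f w - M k \<le> f v" using osc[OF that(1), of w v] that by (auto simp: B_def)
    qed (use that in auto)
    then show ?thesis by simp
  qed
  have g1: "L k \<le> g x \<and> g x \<le> L k + M k" if k: "k \<in> J" "x \<in> B k" for k x
  proof -
    have le: "L l \<le> L k + M k" if l: "l \<in> J" "x \<in> B l" for l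
    proof -
      obtain w where "w \<in> G \<inter> B k \<inter> B l" using meet[OF k l(2)] by blast
      then show ?thesis using L1[OF l(1), of w] L2[OF k(1), of w] by auto
    qed
    have "L k \<le> g x" unfolding g_def using k le by (intro cSUP_upper bdd_aboveI2[where M="L k + M k"]) auto
    moreover have "g x \<le> L k + M k" unfolding g_def using k le by (intro cSUP_least) auto
    ultimately show ?thesis ..
  qed
  show thesis
  proof (rule that)
    fix k u v assume "k \<in> J" "u \<in> ball (c k) (R k)" "v \<in> ball (c k) (R k)"
    then show "\<bar>g u - g v\<bar> \<le> M k" using g1[of k u] g1[of k v] by (auto simp: B_def)
  next
    fix k u assume "k \<in> J" "u \<in> G \<inter> ball (c k) (R k)"
    then show "\<bar>g u - f u\<bar> \<le> M k" using g1[of k u] L1[of k u] L2[of k u] by (auto simp: B_def)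
  qed
qed

text \<open>One fixed realisation of the sample, with all probability removed. The assumption
  \<open>equi\<close> records the outcome of the discrete Morrey estimate, \<open>lower\<close> the
  lower bound on the density.\<close>

locale sample_limit =
  fixes \<Omega> :: "'a::euclidean_space set" and \<mu> :: "'a measure" and X :: "nat \<Rightarrow> 'a"
    and \<phi> :: "nat \<Rightarrow> 'a \<Rightarrow> real" and f :: "'a \<Rightarrow> real" and p \<gamma> c\<^sub>0 C :: real
  assumes op: "open \<Omega>"
    and prob: "prob_space \<mu>" and sets_\<mu> [measurable_cong]: "sets \<mu> = sets borel"
    and AE_\<Omega>: "AE z in \<mu>. z \<in> \<Omega>"
    and c0: "c\<^sub>0 > 0"
    and lower: "\<And>u r. r > 0 \<Longrightarrow> ball u r \<subseteq> \<Omega> \<Longrightarrow> c\<^sub>0 * r ^ DIM('a) \<le> measure \<mu> (ball u r)"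
    and f [measurable]: "f \<in> borel_measurable borel"
    and conv: "tlp_converges p \<Omega>
           (\<lambda>n. (empirical_measure X n, extend_by_zero (sample_points X n) (\<phi> n))) (\<mu>, f)"
    and p: "p > 0" and \<gamma>: "\<gamma> > 0" and C: "C \<ge> 0"
    and equi: "\<And>R e. R > 0 \<Longrightarrow> e > 0 \<Longrightarrow> \<forall>\<^sub>F n in sequentially. \<forall>i\<in>{1..n}. \<forall>j\<in>{1..n}.
        dist (X i) (X j) \<le> R \<longrightarrow> ball (X i) (4 * R) \<subseteq> \<Omega> \<longrightarrow>
        \<bar>\<phi> n (X i) - \<phi> n (X j)\<bar> \<le> C * R powr \<gamma> + e"
begin

lemma selection:
  assumes "\<alpha> > 0" "t > 0"
  shows "\<forall>\<^sub>F n in sequentially. \<forall>A\<in>sets borel. measure \<mu> A \<ge> \<alpha> \<longrightarrow>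
           (\<exists>i\<in>{1..n}. \<exists>y\<in>A. dist (X i) y < t \<and> \<bar>\<phi> n (X i) - f y\<bar> < t)"
  using tlp_converges_selection[OF conv p prob assms] .

text \<open>If both level sets had positive measure, \<open>selection\<close> would place sample
  values near each of them, too far apart for \<open>equi\<close>. The selected points lie within 2R
  of \<open>c\<close>, hence within 4R of each other; \<open>equi\<close> at radius 4R asks for
  balls of radius 16R, and 2R + 16R stays below 20R.\<close>

lemma level_sets_null:
  assumes R: "R > 0" and sub: "ball c (20 * R) \<subseteq> \<Omega>" and gap: "\<alpha> - \<beta> > C * (4 * R) powr \<gamma>"
  shows "measure \<mu> {y\<in>ball c R. f y > \<alpha>} = 0 \<or> measure \<mu> {y\<in>ball c R. f y < \<beta>} = 0"
proof (rule ccontr)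
  let ?A = "{y\<in>ball c R. f y > \<alpha>}" and ?B = "{y\<in>ball c R. f y < \<beta>}"
  assume "\<not> ?thesis"
  then have pos: "measure \<mu> ?A > 0" "measure \<mu> ?B > 0" by (auto simp: zero_less_measure_iff)
  define a where "a = min (measure \<mu> ?A) (measure \<mu> ?B)"
  define \<delta> where "\<delta> = \<alpha> - \<beta> - C * (4 * R) powr \<gamma>"
  \<comment> \<open>One \<open>e\<close> for the error in \<open>equi\<close> and one for each of
    the two selections leave the gap 4 e unfilled.\<close>
  define e where "e = \<delta> / 4"
  define t where "t = min R e"
  have a: "a > 0" using pos by (simp add: a_def)
  have e: "e > 0" using gap by (simp add: e_def \<delta>_def)
  have t: "t > 0" "t \<le> R" "t \<le> e" using R e by (auto simp: t_def)
  have [measurable]: "ball c R \<in> sets borel" by simp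
  have mA: "?A \<in> sets borel" and mB: "?B \<in> sets borel" by measurable
  have R4: "4 * R > 0" using R by simp
  have "\<forall>\<^sub>F n in sequentially. False"
    using selection[OF a t(1)] equi[OF R4 e]
  proof eventually_elim
    case (elim n)
    obtain i y where i: "i \<in> {1..n}" "y \<in> ?A" "dist (X i) y < t" "\<bar>\<phi> n (X i) - f y\<bar> < t"
      using elim(1)[rule_format, OF mA] by (auto simp: a_def)
    obtain j z where j: "j \<in> {1..n}" "z \<in> ?B" "dist (X j) z < t" "\<bar>\<phi> n (X j) - f z\<bar> < t"
      using elim(1)[rule_format, OF mB] by (auto simp: a_def)
    have di: "dist c (X i) < 2 * R" and dj: "dist c (X j) < 2 * R"
      using i j t dist_triangle[of c "X i" y] dist_triangle[of c "X j" z] by (auto simp: dist_commute)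
    have "ball (X i) (4 * (4 * R)) \<subseteq> ball c (20 * R)"
      using di by (intro ball_subset_ball_iff[THEN iffD2]) (auto simp: dist_commute)
    moreover have "dist (X i) (X j) \<le> 4 * R"
      using di dj dist_triangle[of "X i" "X j" c] by (simp add: dist_commute)
    ultimately have "\<bar>\<phi> n (X i) - \<phi> n (X j)\<bar> \<le> C * (4 * R) powr \<gamma> + e"
      using elim(2) i(1) j(1) sub by auto
    moreover have "f y > \<alpha>" "f z < \<beta>" using i j by auto
    moreover have "4 * e = \<alpha> - \<beta> - C * (4 * R) powr \<gamma>" by (simp add: e_def flip: \<delta>_def)
    ultimately show False using i(4) j(4) t e by (simp add: abs_if split: if_splits)
  qed
  then show False by simp
qed

text \<open>Restricting to countably many balls and rational levels makes all exceptional level sets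
  together null. Off that null set, \<open>f\<close> satisfies the oscillation bound everywhere, and
  the set is dense because balls in \<Omega> have positive measure, so
  \<open>dense_extension\<close> applies. Shrinking the ball around a point of G then gives
  \<open>f = g\<close> there.\<close>

lemma holder_representative:
  obtains g where "AE z in \<mu>. f z = g z"
    "\<And>c R u v. R > 0 \<Longrightarrow> ball c (41 * R) \<subseteq> \<Omega> \<Longrightarrow> u \<in> ball c R \<Longrightarrow> v \<in> ball c R
        \<Longrightarrow> \<bar>g u - g v\<bar> \<le> C * 8 powr \<gamma> * R powr \<gamma>"
proof -
  interpret prob_space \<mu> by (rule prob)
  obtain D :: "'a set" where D: "countable D" "\<And>U. open U \<Longrightarrow> U \<noteq> {} \<Longrightarrow> \<exists>d\<in>D. d \<in> U"
    using countable_dense_exists by metis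
  define J where "J = {(c, R). c \<in> D \<and> R \<in> \<rat> \<and> R > 0 \<and> ball c (20 * R) \<subseteq> \<Omega>}"
  have "J \<subseteq> D \<times> \<rat>" by (auto simp: J_def)
  then have cJ: "countable J" using D(1) countable_rat by (blast intro: countable_subset countable_SIGMA)
  \<comment> \<open>A good point avoids every upper or lower level set of \<open>f\<close> in the
    k-th ball that is null.\<close>
  define good where "good k \<alpha> y \<longleftrightarrow>
     (measure \<mu> {y\<in>ball (fst k) (snd k). f y > \<alpha>} = 0 \<longrightarrow> \<not> (y \<in> ball (fst k) (snd k) \<and> f y > \<alpha>)) \<and>
     (measure \<mu> {y\<in>ball (fst k) (snd k). f y < \<alpha>} = 0 \<longrightarrow> \<not> (y \<in> ball (fst k) (snd k) \<and> f y < \<alpha>))"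
    for k :: "'a \<times> real" and \<alpha> :: real and y
  define G where "G = {y\<in>\<Omega>. \<forall>k\<in>J. \<forall>\<alpha>\<in>\<rat>. good k \<alpha> y}"
  have "AE y in \<mu>. good k \<alpha> y" for k \<alpha>
  proof -
    have [measurable]: "ball (fst k) (snd k) \<in> sets borel" by simp
    have space: "space \<mu> = UNIV" using sets_eq_imp_space_eq[OF sets_\<mu>] by simp
    have m1: "{y\<in>ball (fst k) (snd k). f y > \<alpha>} \<in> sets \<mu>" "{y\<in>ball (fst k) (snd k). f y < \<alpha>} \<in> sets \<mu>"
      by measurable
    have "AE y in \<mu>. measure \<mu> {y\<in>ball (fst k) (snd k). f y > \<alpha>} = 0 \<longrightarrow> \<not> (y \<in> ball (fst k) (snd k) \<and> f y > \<alpha>)"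
    proof (cases "measure \<mu> {y\<in>ball (fst k) (snd k). f y > \<alpha>} = 0")
      case True
      then have "{y\<in>ball (fst k) (snd k). f y > \<alpha>} \<in> null_sets \<mu>"
        using m1 by (simp add: null_sets_def emeasure_eq_measure)
      from AE_not_in[OF this] show ?thesis by eventually_elim auto
    qed auto
    moreover have "AE y in \<mu>. measure \<mu> {y\<in>ball (fst k) (snd k). f y < \<alpha>} = 0 \<longrightarrow> \<not> (y \<in> ball (fst k) (snd k) \<and> f y < \<alpha>)"
    proof (cases "measure \<mu> {y\<in>ball (fst k) (snd k). f y < \<alpha>} = 0")
      case True
      then have "{y\<in>ball (fst k) (snd k). f y < \<alpha>} \<in> null_sets \<mu>"
        using m1 by (simp add: null_sets_def emeasure_eq_measure)
      from AE_not_in[OF this] show ?thesis by eventually_elim auto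
    qed auto
    ultimately show ?thesis unfolding good_def by eventually_elim blast
  qed
  then have "AE y in \<mu>. \<forall>k\<in>J. \<forall>\<alpha>\<in>\<rat>. good k \<alpha> y"
    by (intro AE_ball_countable[OF cJ, THEN iffD2] AE_ball_countable[OF countable_rat, THEN iffD2] ballI)
  with AE_\<Omega> have AE_G: "AE y in \<mu>. y \<in> G" unfolding G_def by eventually_elim blast
  have dense: "ball x r \<inter> G \<noteq> {}" if "r > 0" "ball x r \<subseteq> \<Omega>" for x r
  proof
    assume emp: "ball x r \<inter> G = {}"
    have "AE y in \<mu>. y \<notin> ball x r" using AE_G by eventually_elim (use emp in blast)
    then have "measure \<mu> (ball x r) = 0"
      using AE_iff_null_sets[of "ball x r" \<mu>] by (auto simp: sets_\<mu> measure_eq_0_null_sets)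
    moreover have "0 < c\<^sub>0 * r ^ DIM('a)" using c0 that by simp
    ultimately show False using lower[OF that] by simp
  qed
  obtain g where g1: "\<And>k u v. k \<in> J \<Longrightarrow> u \<in> ball (fst k) (snd k) \<Longrightarrow> v \<in> ball (fst k) (snd k)
        \<Longrightarrow> \<bar>g u - g v\<bar> \<le> C * (4 * snd k) powr \<gamma>"
    and g2: "\<And>k u. k \<in> J \<Longrightarrow> u \<in> G \<inter> ball (fst k) (snd k) \<Longrightarrow> \<bar>g u - f u\<bar> \<le> C * (4 * snd k) powr \<gamma>"
  proof (rule dense_extension[where \<Omega>=\<Omega> and G=G and J=J and c=fst and R=snd and f=f and M="\<lambda>k. C * (4 * snd k) powr \<gamma>"])
    show "ball x r \<inter> G \<noteq> {}" if "r > 0" "ball x r \<subseteq> \<Omega>" for x r using dense[OF that] .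
    show "ball (fst k) (snd k) \<subseteq> \<Omega>" if "k \<in> J" for k
    proof -
      have "ball (fst k) (snd k) \<subseteq> ball (fst k) (20 * snd k)" using that by (intro subset_ball) (auto simp: J_def)
      then show ?thesis using that by (auto simp: J_def)
    qed
    show "f u - f v \<le> C * (4 * snd k) powr \<gamma>"
      if k: "k \<in> J" and uv: "u \<in> G \<inter> ball (fst k) (snd k)" "v \<in> G \<inter> ball (fst k) (snd k)" for k u v
    proof (rule ccontr)
      assume "\<not> ?thesis"
      then have "f v + C * (4 * snd k) powr \<gamma> < f u" by simp
      \<comment> \<open>Two rational levels are fitted into the excess oscillation, still separated
        by more than the bound, so that one of the two level sets is null although \<open>u\<close>
        and \<open>v\<close> witness both.\<close>
      then obtain \<alpha> where \<alpha>: "\<alpha> \<in> \<rat>" "f v + C * (4 * snd k) powr \<gamma> < \<alpha>" "\<alpha> < f u"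
        using Rats_dense_in_real by blast
      then have "f v < \<alpha> - C * (4 * snd k) powr \<gamma>" by simp
      then obtain \<beta> where \<beta>: "\<beta> \<in> \<rat>" "f v < \<beta>" "\<beta> < \<alpha> - C * (4 * snd k) powr \<gamma>"
        using Rats_dense_in_real by blast
      have "measure \<mu> {y\<in>ball (fst k) (snd k). f y > \<alpha>} = 0 \<or> measure \<mu> {y\<in>ball (fst k) (snd k). f y < \<beta>} = 0"
        using k \<beta> by (intro level_sets_null) (auto simp: J_def)
      moreover have "good k \<alpha> u" "good k \<beta> v" using k uv \<alpha> \<beta> by (auto simp: G_def)
      ultimately show False using uv \<alpha> \<beta> by (auto simp: good_def)
    qed
  next
    fix g
    assume 1: "\<And>k u v. k \<in> J \<Longrightarrow> u \<in> ball (fst k) (snd k) \<Longrightarrow> v \<in> ball (fst k) (snd k)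
        \<Longrightarrow> \<bar>g u - g v\<bar> \<le> C * (4 * snd k) powr \<gamma>"
      and 2: "\<And>k u. k \<in> J \<Longrightarrow> u \<in> G \<inter> ball (fst k) (snd k) \<Longrightarrow> \<bar>g u - f u\<bar> \<le> C * (4 * snd k) powr \<gamma>"
    show thesis by (rule that[OF 1 2])
  qed
  \<comment> \<open>An arbitrary ball is enclosed in one from the countable family, with R < R' < 2R
    and centres closer than R' - R. Then 20 R' + (R' - R) < 41 R, and 4 R' < 8 R explains the factor
    \<open>8 powr \<gamma>\<close>.\<close>
  have smallball: "\<exists>k\<in>J. ball c R \<subseteq> ball (fst k) (snd k) \<and> snd k \<le> 2 * R"
    if R: "R > 0" and sub: "ball c (41 * R) \<subseteq> \<Omega>" for c R
  proof -
    obtain R' where R': "R' \<in> \<rat>" "R < R'" "R' < 2 * R" using Rats_dense_in_real[of R "2 * R"] R by auto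
    obtain c' where c': "c' \<in> D" "c' \<in> ball c (R' - R)" using D(2)[of "ball c (R' - R)"] R' by auto
    have "ball c' (20 * R') \<subseteq> ball c (41 * R)"
      using c' R' by (intro ball_subset_ball_iff[THEN iffD2]) (auto simp: dist_commute)
    moreover have "ball c R \<subseteq> ball c' R'"
      using c' R' by (intro ball_subset_ball_iff[THEN iffD2]) auto
    ultimately show ?thesis using R R' c' sub by (intro bexI[of _ "(c', R')"]) (auto simp: J_def)
  qed
  have M: "C * (4 * R') powr \<gamma> \<le> C * 8 powr \<gamma> * R powr \<gamma>" if "0 < R'" "R' \<le> 2 * R" for R R'
  proof -
    have "(4 * R') powr \<gamma> \<le> (8 * R) powr \<gamma>" using that \<gamma> by (intro powr_mono2) auto
    then show ?thesis using C that by (simp add: powr_mult mult_left_mono mult.assoc)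
  qed
  show thesis
  proof (rule that)
    fix c R u v assume R: "R > 0" "ball c (41 * R) \<subseteq> \<Omega>" and uv: "u \<in> ball c R" "v \<in> ball c R"
    obtain k where k: "k \<in> J" "ball c R \<subseteq> ball (fst k) (snd k)" "snd k \<le> 2 * R" using smallball[OF R] by blast
    have "\<bar>g u - g v\<bar> \<le> C * (4 * snd k) powr \<gamma>" using k uv by (intro g1) auto
    also have "\<dots> \<le> C * 8 powr \<gamma> * R powr \<gamma>" using k by (intro M) (auto simp: J_def)
    finally show "\<bar>g u - g v\<bar> \<le> C * 8 powr \<gamma> * R powr \<gamma>" .
  next
    have fg: "f u = g u" if u: "u \<in> G" for u
    proof -
      have "u \<in> \<Omega>" using u by (simp add: G_def)
      then obtain r0 where r0: "r0 > 0" "ball u r0 \<subseteq> \<Omega>" by (rule openE[OF op])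
      have "((\<lambda>R. C * 8 powr \<gamma> * R powr \<gamma>) \<longlongrightarrow> C * 8 powr \<gamma> * 0 powr \<gamma>) (at_right 0)"
        using \<gamma> by (intro tendsto_intros) (auto simp: eventually_at_filter)
      then have lim: "((\<lambda>R. C * 8 powr \<gamma> * R powr \<gamma>) \<longlongrightarrow> 0) (at_right 0)" by simp
      have "\<forall>\<^sub>F R in at_right 0. R \<in> {0<..<r0 / 41}"
        using r0 by (intro eventually_at_right_real) auto
      then have "\<forall>\<^sub>F R in at_right 0. \<bar>g u - f u\<bar> \<le> C * 8 powr \<gamma> * R powr \<gamma>"
      proof eventually_elim
        case (elim R)
        then have R: "R > 0" "41 * R \<le> r0" by auto
        then have "ball u (41 * R) \<subseteq> \<Omega>" using r0 subset_ball by blast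
        then obtain k where k: "k \<in> J" "ball u R \<subseteq> ball (fst k) (snd k)" "snd k \<le> 2 * R" using smallball R by blast
        have "\<bar>g u - f u\<bar> \<le> C * (4 * snd k) powr \<gamma>" using k u R by (intro g2) (auto dest!: subsetD[of _ _ u])
        also have "\<dots> \<le> C * 8 powr \<gamma> * R powr \<gamma>" using k by (intro M) (auto simp: J_def)
        finally show ?case .
      qed
      then have "\<bar>g u - f u\<bar> \<le> 0"
        by (rule tendsto_lowerbound[OF lim]) simp
      then show ?thesis by simp
    qed
    show "AE z in \<mu>. f z = g z" using AE_G by eventually_elim (rule fg)
  qed
qed

text \<open>Compactness gives one radius that works around all points of \<Omega>'. Each sample
  point is then linked to \<open>g\<close> by the chain: nearby selected sample point
  (\<open>equi\<close>), its typical partner y (\<open>selection\<close>), and back from y to the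
  sample point (\<open>osc\<close>). The thresholds on n do not depend on the sample point.\<close>

lemma max_deviation_tendsto_0:
  assumes fg: "AE z in \<mu>. f z = g z"
    and osc: "\<And>c R u v. R > 0 \<Longrightarrow> ball c (41 * R) \<subseteq> \<Omega> \<Longrightarrow> u \<in> ball c R \<Longrightarrow> v \<in> ball c R
        \<Longrightarrow> \<bar>g u - g v\<bar> \<le> C' * R powr \<gamma>"
    and cc: "compactly_contained \<Omega>' \<Omega>"
  shows "(\<lambda>n. max_deviation X n \<Omega>' g (\<phi> n)) \<longlonglongrightarrow> 0"
proof -
  interpret prob_space \<mu> by (rule prob)
  have space: "space \<mu> = UNIV" using sets_eq_imp_space_eq[OF sets_\<mu>] by simp
  \<comment> \<open>Deleting this null set from the balls forces the selected partner to satisfy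
    \<open>f y = g y\<close> without changing any measure.\<close>
  obtain N where N: "{z. f z \<noteq> g z} \<subseteq> N" "emeasure \<mu> N = 0" "N \<in> sets \<mu>"
    using AE_E[OF fg] by (auto simp: space)
  obtain r1 where r1: "r1 > 0" "(\<Union>x\<in>closure \<Omega>'. ball x r1) \<subseteq> \<Omega>"
    using compact_subset_open_imp_ball_epsilon_subset[of "closure \<Omega>'" \<Omega>] cc op
    by (auto simp: compactly_contained_def)
  show ?thesis
  proof (rule tendstoI)
    fix e :: real assume e: "e > 0"
    have "((\<lambda>R. C' * R powr \<gamma>) \<longlongrightarrow> C' * 0 powr \<gamma>) (at_right 0)"
         "((\<lambda>R. C * (2 * R) powr \<gamma>) \<longlongrightarrow> C * (2 * 0) powr \<gamma>) (at_right 0)"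
      using \<gamma> by (intro tendsto_intros; auto simp: eventually_at_filter)+
    then have "((\<lambda>R. C' * R powr \<gamma>) \<longlongrightarrow> 0) (at_right 0)" "((\<lambda>R. C * (2 * R) powr \<gamma>) \<longlongrightarrow> 0) (at_right 0)"
      by simp_all
    then have "\<forall>\<^sub>F R in at_right 0. C' * R powr \<gamma> < e / 4" "\<forall>\<^sub>F R in at_right 0. C * (2 * R) powr \<gamma> < e / 4"
      using order_tendstoD(2)[of _ 0 "at_right 0" "e / 4"] e by simp_all
    moreover have "\<forall>\<^sub>F R in at_right 0. R \<in> {0<..<r1 / 41}"
      using r1 by (intro eventually_at_right_real) auto
    ultimately have "\<forall>\<^sub>F R in at_right 0. C' * R powr \<gamma> < e / 4 \<and> C * (2 * R) powr \<gamma> < e / 4 \<and> R \<in> {0<..<r1 / 41}"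
      by (intro eventually_conj)
    from eventually_happens'[OF trivial_limit_at_right_real this]
    obtain R where "C' * R powr \<gamma> < e / 4 \<and> C * (2 * R) powr \<gamma> < e / 4 \<and> R \<in> {0<..<r1 / 41}" by blast
    then have R: "C' * R powr \<gamma> < e / 4" "C * (2 * R) powr \<gamma> < e / 4" "0 < R" "41 * R < r1" by simp_all
    define t where "t = min R (e / 8)"
    have t: "t > 0" "t \<le> R" "t \<le> e / 8" using R e by (auto simp: t_def)
    have \<alpha>: "c\<^sub>0 * R ^ DIM('a) > 0" using c0 R by simp
    have e8: "e / 8 > 0" using e by simp
    have R2: "2 * R > 0" using R by simp
    show "\<forall>\<^sub>F n in sequentially. dist (max_deviation X n \<Omega>' g (\<phi> n)) 0 < e"
      using selection[OF \<alpha> t(1)] equi[OF R2 e8]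
    proof eventually_elim
      case (elim n)
      \<comment> \<open>The errors are e/4 + e/8 from \<open>equi\<close>, e/8 from
        \<open>selection\<close> and e/4 from \<open>osc\<close>. A bound strictly below e survives
        the maximum.\<close>
      have "\<bar>g (X k) - \<phi> n (X k)\<bar> \<le> 7 / 8 * e" if k: "k \<in> {1..n}" "X k \<in> \<Omega>'" for k
      proof -
        have "X k \<in> closure \<Omega>'" using k closure_subset by blast
        then have sub: "ball (X k) s \<subseteq> \<Omega>" if "s \<le> 41 * R" for s
          using r1 R that subset_ball[of s r1 "X k"] by force
        have "c\<^sub>0 * R ^ DIM('a) \<le> measure \<mu> (ball (X k) R)" using R by (intro lower sub) auto
        also have "\<dots> = measure \<mu> (ball (X k) R - N)"
          using N by (intro measure_Diff_null_set[symmetric]) (auto simp: sets_\<mu> null_sets_def)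
        finally have le: "c\<^sub>0 * R ^ DIM('a) \<le> measure \<mu> (ball (X k) R - N)" .
        have "ball (X k) R - N \<in> sets borel" using N(3) by (auto simp: sets_\<mu>)
        from elim(1)[rule_format, OF this le] obtain i y where i: "i \<in> {1..n}" "y \<in> ball (X k) R - N" "dist (X i) y < t" "\<bar>\<phi> n (X i) - f y\<bar> < t"
          by blast
        have "dist (X k) (X i) \<le> 2 * R"
          using i t dist_triangle[of "X k" "X i" y] by (auto simp: dist_commute)
        then have 1: "\<bar>\<phi> n (X k) - \<phi> n (X i)\<bar> \<le> C * (2 * R) powr \<gamma> + e / 8"
          using elim(2) k(1) i(1) sub[of "4 * (2 * R)"] R by auto
        have 2: "\<bar>g y - g (X k)\<bar> \<le> C' * R powr \<gamma>"
          using i R by (intro osc[of R "X k"] sub) auto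
        have "f y = g y" using i N by blast
        then show ?thesis using 1 2 i(4) t R e by linarith
      qed
      then have "max_deviation X n \<Omega>' g (\<phi> n) \<le> 7 / 8 * e"
        unfolding max_deviation_def using e by (intro Max.boundedI) auto
      moreover have "max_deviation X n \<Omega>' g (\<phi> n) \<ge> 0"
        unfolding max_deviation_def by (intro Max_ge) auto
      ultimately show ?case using e by simp
    qed
  qed
qed

lemma limit_holder_and_uniform:
  assumes "bounded \<Omega>" "lipschitz_boundary \<Omega>"
  shows "\<exists>g. continuous_on \<Omega> g \<and> (AE z in \<mu>. f z = g z) \<and> g \<in> holder_space \<gamma> \<Omega> \<and>
    (\<forall>\<Omega>'. compactly_contained \<Omega>' \<Omega> \<longrightarrow> (\<lambda>n. max_deviation X n \<Omega>' g (\<phi> n)) \<longlonglongrightarrow> 0)"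
proof -
  obtain g where fg: "AE z in \<mu>. f z = g z" and
    osc: "\<And>c R u v. R > 0 \<Longrightarrow> ball c (41 * R) \<subseteq> \<Omega> \<Longrightarrow> u \<in> ball c R \<Longrightarrow> v \<in> ball c R
        \<Longrightarrow> \<bar>g u - g v\<bar> \<le> C * 8 powr \<gamma> * R powr \<gamma>"
    using holder_representative by blast
  have cont: "continuous_on \<Omega> g" by (rule oscillation_imp_continuous[OF osc _ \<gamma> op]) auto
  have "g \<in> holder_space \<gamma> \<Omega>"
    using C by (intro interior_oscillation_imp_holder[OF osc _ \<gamma> _ op cont assms]) auto
  moreover have "(\<lambda>n. max_deviation X n \<Omega>' g (\<phi> n)) \<longlonglongrightarrow> 0" if "compactly_contained \<Omega>' \<Omega>" for \<Omega>'
    by (rule max_deviation_tendsto_0[OF fg osc that])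
  ultimately show ?thesis using fg cont by blast
qed

end

subsection \<open>Counting random sample points in balls\<close>

text \<open>A separated set of maximal cardinality is a net, since an uncovered centre could be
  added. Maximal cardinality exists because the balls of half radius are disjoint and each carries a
  fixed mass.\<close>

lemma separated_net:
  fixes \<Omega> :: "'a::euclidean_space set"
  assumes prob: "prob_space \<mu>" and sets: "sets \<mu> = sets borel" and c0: "c\<^sub>0 > 0"
    and lower: "\<And>u r. r > 0 \<Longrightarrow> ball u r \<subseteq> \<Omega> \<Longrightarrow> c\<^sub>0 * r ^ DIM('a) \<le> measure \<mu> (ball u r)"
    and s: "s > 0"
  obtains D :: "'a set" where "finite D" "real (card D) * (c\<^sub>0 * (s / 2) ^ DIM('a)) \<le> 1"
    "\<And>q. q \<in> D \<Longrightarrow> ball q s \<subseteq> \<Omega>" "\<And>u. ball u s \<subseteq> \<Omega> \<Longrightarrow> \<exists>q\<in>D. dist u q < s"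
proof -
  interpret prob_space \<mu> by (rule prob)
  define b where "b = c\<^sub>0 * (s / 2) ^ DIM('a)"
  have b: "b > 0" using c0 s by (simp add: b_def)
  define P where "P D \<longleftrightarrow> finite D \<and> (\<forall>q\<in>D. ball q s \<subseteq> \<Omega>) \<and> (\<forall>q\<in>D. \<forall>q'\<in>D. q \<noteq> q' \<longrightarrow> dist q q' \<ge> s)"
    for D :: "'a set"
  have card: "real (card D) * b \<le> 1" if D: "P D" for D
  proof -
    have disj: "disjoint_family_on (\<lambda>q. ball q (s / 2)) D"
      unfolding disjoint_family_on_def
    proof (intro ballI impI)
      fix q q' assume "q \<in> D" "q' \<in> D" "q \<noteq> q'"
      then have d: "dist q q' \<ge> s" using D by (auto simp: P_def)
      show "ball q (s / 2) \<inter> ball q' (s / 2) = {}"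
      proof (rule ccontr)
        assume "ball q (s / 2) \<inter> ball q' (s / 2) \<noteq> {}"
        then obtain z where "dist q z < s / 2" "dist q' z < s / 2" by auto
        then show False using d dist_triangle[of q q' z] by (simp add: dist_commute)
      qed
    qed
    have "real (card D) * b = (\<Sum>q\<in>D. b)" by simp
    also have "\<dots> \<le> (\<Sum>q\<in>D. measure \<mu> (ball q (s / 2)))"
    proof (rule sum_mono)
      fix q assume "q \<in> D"
      then have "ball q s \<subseteq> \<Omega>" using D by (auto simp: P_def)
      moreover have "ball q (s / 2) \<subseteq> ball q s" using s by (intro subset_ball) auto
      ultimately show "b \<le> measure \<mu> (ball q (s / 2))"
        unfolding b_def using s by (intro lower) auto
    qed
    also have "\<dots> = measure \<mu> (\<Union>q\<in>D. ball q (s / 2))"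
      using D disj by (intro finite_measure_finite_Union[symmetric]) (auto simp: P_def sets)
    also have "\<dots> \<le> 1" by simp
    finally show ?thesis .
  qed
  have P0: "P {}" by (simp add: P_def)
  have bound: "card D < Suc (nat \<lfloor>1 / b\<rfloor>)" if "P D" for D
  proof -
    have "real (card D) \<le> 1 / b" using card[OF that] b by (simp add: field_simps)
    then show ?thesis by (simp add: le_nat_floor less_Suc_eq_le)
  qed
  then obtain D where D: "P D" "\<And>D'. P D' \<Longrightarrow> card D' \<le> card D"
    using ex_has_greatest_nat[of P "{}" card] P0 by (metis less_imp_le)
  have "\<exists>q\<in>D. dist u q < s" if u: "ball u s \<subseteq> \<Omega>" for u
  proof (rule ccontr)
    assume no: "\<not> ?thesis"
    then have "P (insert u D)" using D(1) u by (auto simp: P_def dist_commute not_less)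
    moreover have "u \<notin> D" using no s by force
    ultimately show False using D(2)[of "insert u D"] D(1) by (simp add: P_def)
  qed
  then show ?thesis using that[of D] D(1) card[OF D(1)] by (auto simp: P_def b_def)
qed

text \<open>Exponential Markov inequality with parameter 1 for minus the number of hits. Each
  independent factor is 1 - q + q/e, at most 1 - q/2 and so at most exp(-q/2); the threshold q |I| /
  4 uses up half of the resulting exponent.\<close>

lemma (in prob_space) prob_few_hits:
  fixes x :: "'i \<Rightarrow> 'a \<Rightarrow> 'b::{second_countable_topology, t2_space}"
  assumes I: "finite I" and ind: "indep_vars (\<lambda>_. borel) x I" and A: "A \<in> sets borel"
    and q: "\<And>i. i \<in> I \<Longrightarrow> measure (distr M borel (x i)) A = q"
  shows "prob {\<omega>\<in>space M. real (card {i\<in>I. x i \<omega> \<in> A}) \<le> q * real (card I) / 4}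
           \<le> exp (- (q * real (card I) / 4))"
\<comment> \<open>For empty \<open>I\<close> nothing constrains \<open>q\<close>, but the bound is
  then exp 0 = 1.\<close>
proof (cases "I = {}")
  case True
  then show ?thesis by simp
next
  case False
  then obtain i0 where i0: "i0 \<in> I" by blast
  have rv: "x i \<in> borel_measurable M" if "i \<in> I" for i
    using ind that by (auto simp: indep_vars_def)
  interpret d: prob_space "distr M borel (x i0)" by (rule prob_space_distr[OF rv[OF i0]])
  have q01: "0 \<le> q" "q \<le> 1" using q[OF i0] d.prob_le_1[of A] measure_nonneg by metis+
  define S where "S \<omega> = (\<Sum>i\<in>I. indicator A (x i \<omega>) :: real)" for \<omega>
  have S: "S \<omega> = real (card {i\<in>I. x i \<omega> \<in> A})" for \<omega>
    using I by (simp add: S_def indicator_def sum.If_cases Int_def)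
  have mS [measurable]: "S \<in> borel_measurable M"
    unfolding S_def using rv A by (intro borel_measurable_sum measurable_compose[OF rv] borel_measurable_indicator) auto
  have one: "(\<integral>\<^sup>+\<omega>. ennreal (exp (- indicator A (x i \<omega>))) \<partial>M) \<le> ennreal (exp (- q / 2))" if i: "i \<in> I" for i
  proof -
    note rv[OF i, measurable]
    note A[measurable]
    interpret di: prob_space "distr M borel (x i)" by (rule prob_space_distr[OF rv[OF i]])
    have eA: "emeasure (distr M borel (x i)) A = ennreal q"
      using q[OF i] by (simp add: di.emeasure_eq_measure)
    have eA': "emeasure (distr M borel (x i)) (- A) = ennreal (1 - q)"
      using q[OF i] di.prob_compl[of A] A by (simp add: di.emeasure_eq_measure Compl_eq_Diff_UNIV)
    have "(\<integral>\<^sup>+\<omega>. ennreal (exp (- indicator A (x i \<omega>))) \<partial>M)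
       = (\<integral>\<^sup>+z. ennreal (exp (- indicator A z)) \<partial>distr M borel (x i))"
      by (subst nn_integral_distr) auto
    also have "\<dots> = (\<integral>\<^sup>+z. ennreal (exp (- 1)) * indicator A z + indicator (- A) z \<partial>distr M borel (x i))"
      by (intro nn_integral_cong) (auto simp: indicator_def)
    also have "\<dots> = ennreal (exp (- 1)) * ennreal q + ennreal (1 - q)"
      using A by (subst nn_integral_add) (auto simp: nn_integral_cmult eA eA' borel_comp)
    also have "\<dots> = ennreal (exp (- 1) * q + (1 - q))"
      using q01 by (simp add: ennreal_mult')
    also have "\<dots> \<le> ennreal (exp (- q / 2))"
    proof (rule ennreal_leI)
      have "2 \<le> exp (1::real)" using exp_ge_add_one_self[of 1] by simp
      then have "exp (- 1) \<le> (1 / 2 :: real)" by (simp add: exp_minus field_simps)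
      then have "exp (- 1) * q \<le> 1 / 2 * q" using q01 by (intro mult_right_mono)
      then show "exp (- 1) * q + (1 - q) \<le> exp (- q / 2)"
        using exp_ge_add_one_self[of "- q / 2"] by simp
    qed
    finally show ?thesis .
  qed
  have "emeasure M {\<omega>\<in>space M. S \<omega> \<le> q * real (card I) / 4}
     \<le> ennreal (exp (1 * (q * real (card I) / 4))) * (\<integral>\<^sup>+\<omega>. ennreal (exp (- 1 * S \<omega>)) * indicator (space M) \<omega> \<partial>M)"
    by (rule Chernoff_ineq_nn_integral_le) auto
  also have "(\<integral>\<^sup>+\<omega>. ennreal (exp (- 1 * S \<omega>)) * indicator (space M) \<omega> \<partial>M)
       = (\<integral>\<^sup>+\<omega>. (\<Prod>i\<in>I. ennreal (exp (- indicator A (x i \<omega>)))) \<partial>M)"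
    by (intro nn_integral_cong) (simp add: S_def prod_ennreal exp_sum[OF I] sum_negf[symmetric])
  also have "\<dots> = (\<Prod>i\<in>I. \<integral>\<^sup>+\<omega>. ennreal (exp (- indicator A (x i \<omega>))) \<partial>M)"
    using A by (intro indep_vars_nn_integral[OF I] indep_vars_compose2[OF ind]) auto
  also have "\<dots> \<le> (\<Prod>i\<in>I. ennreal (exp (- q / 2)))" by (intro prod_mono_ennreal one)
  also have "\<dots> = ennreal (exp (- (q * real (card I) / 2)))"
    by (simp add: ennreal_power exp_of_nat_mult[symmetric] mult_ac)
  finally have "emeasure M {\<omega>\<in>space M. S \<omega> \<le> q * real (card I) / 4}
     \<le> ennreal (exp (1 * (q * real (card I) / 4))) * ennreal (exp (- (q * real (card I) / 2)))"
    by (simp add: mult_left_mono)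
  also have "\<dots> = ennreal (exp (- (q * real (card I) / 4)))"
    by (simp add: ennreal_mult'[symmetric] exp_add[symmetric])
  finally show ?thesis by (simp add: emeasure_eq_measure S)
qed

text \<open>
  For d = 1 and d = 2 the length scale is larger than the Chernoff threshold (log n / n)^(1/d), so a
  single condition covers all dimensions.
\<close>
lemma length_scale_imp_dense_sample:
  fixes \<epsilon> :: "nat \<Rightarrow> real"
  assumes lim: "filterlim (\<lambda>n. \<epsilon> n / length_scale d n) at_top sequentially" and d: "d \<ge> 1"
  shows "filterlim (\<lambda>n. real n * \<epsilon> n ^ d / ln (real n)) at_top sequentially"
proof (rule filterlim_at_top_mono[OF lim])
  define r where "r n = \<epsilon> n / length_scale d n" for n
  \<comment> \<open>Since \<open>r n\<close> is at least 1, it is bounded by its own d-th power, so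
    comparing the length scale itself with the Chernoff threshold suffices.\<close>
  have r: "\<forall>\<^sub>F n in sequentially. r n \<ge> 1"
    using lim unfolding r_def filterlim_at_top by blast
  have ln1: "\<forall>\<^sub>F n in sequentially. ln (real n) \<ge> 1" by real_asymp
  have lnln: "\<forall>\<^sub>F n in sequentially. ln (ln (real n)) > 0" by real_asymp
  have sq: "\<forall>\<^sub>F n in sequentially. ln (real n) \<le> real n * sqrt (ln (ln (real n)) / real n)" by real_asymp
  show "\<forall>\<^sub>F n in sequentially. \<epsilon> n / length_scale d n \<le> real n * \<epsilon> n ^ d / ln (real n)"
    using r ln1 lnln sq eventually_gt_at_top[of 1]
  proof eventually_elim
    case (elim n)
    have l: "length_scale d n > 0" using elim by (simp add: length_scale_def)
    have eps: "\<epsilon> n = r n * length_scale d n" using l by (simp add: r_def)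
    consider "d = 1" | "d = 2" | "d \<ge> 3" using d by linarith
    then have "r n \<le> real n * \<epsilon> n ^ d / ln (real n)"
    proof cases
      case 1
      have "r n * ln (real n) \<le> r n * (real n * sqrt (ln (ln (real n)) / real n))"
        using elim by (intro mult_left_mono) auto
      also have "\<dots> = real n * \<epsilon> n ^ d" unfolding eps by (simp add: 1 length_scale_def)
      finally show ?thesis using elim by (simp add: pos_le_divide_eq)
    next
      case 2
      have "(length_scale d n)\<^sup>2 = (ln (real n) powr (3/4))\<^sup>2 / real n"
        using elim by (simp add: 2 length_scale_def power_divide)
      also have "(ln (real n) powr (3/4))\<^sup>2 = ln (real n) powr (3/2)"
        by (simp add: power2_eq_square flip: powr_add)
      finally have ls: "(length_scale d n)\<^sup>2 = ln (real n) powr (3/2) / real n" .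
      have "ln (real n) = ln (real n) powr 1" using elim by simp
      also have "\<dots> \<le> ln (real n) powr (3/2)" using elim by (intro powr_mono) auto
      finally have "r n * ln (real n) \<le> (r n)\<^sup>2 * ln (real n) powr (3/2)"
        using elim by (intro mult_mono) (auto simp: power2_eq_square)
      also have "\<dots> = real n * \<epsilon> n ^ d" unfolding eps using elim by (simp add: 2 power_mult_distrib ls[unfolded 2])
      finally show ?thesis using elim by (simp add: pos_le_divide_eq)
    next
      case 3
      have "length_scale d n ^ d = ((ln (real n) / real n) powr (1 / real d)) powr real d"
        using 3 elim by (simp add: length_scale_def powr_realpow)
      also have "\<dots> = ln (real n) / real n" using 3 elim by (simp add: powr_powr)
      finally have ls: "length_scale d n ^ d = ln (real n) / real n" .
      have "r n ^ 1 \<le> r n ^ d" using elim d by (intro power_increasing) auto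
      then have "r n * ln (real n) \<le> r n ^ d * ln (real n)" using elim by (intro mult_right_mono) auto
      also have "\<dots> = real n * \<epsilon> n ^ d" unfolding eps using elim by (simp add: power_mult_distrib ls)
      finally show ?thesis using elim by (simp add: pos_le_divide_eq)
    qed
    then show ?case by (simp add: r_def)
  qed
qed

text \<open>If p were at most d, then \<epsilon> < 1 would give n \<epsilon>^d at most n
  \<epsilon>^p, which tends to 0, whereas n \<epsilon>^d eventually exceeds log n.\<close>

lemma dim_less_exponent:
  fixes \<epsilon> :: "nat \<Rightarrow> real"
  assumes inf: "filterlim (\<lambda>n. real n * \<epsilon> n ^ d / ln (real n)) at_top sequentially"
    and pos: "\<forall>n\<ge>1. \<epsilon> n > 0" and eps0: "\<epsilon> \<longlonglongrightarrow> 0"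
    and lim: "(\<lambda>n. real n * \<epsilon> n powr p) \<longlonglongrightarrow> 0"
  shows "real d < p"
proof (rule ccontr)
  assume "\<not> real d < p"
  then have pd: "p \<le> real d" by simp
  have "\<forall>\<^sub>F n in sequentially. real n * \<epsilon> n ^ d / ln (real n) \<ge> 1"
    using inf unfolding filterlim_at_top by blast
  moreover have "\<forall>\<^sub>F n in sequentially. ln (real n) \<ge> 1" by real_asymp
  moreover have "\<forall>\<^sub>F n in sequentially. \<epsilon> n < 1" using eps0 by (rule order_tendstoD) simp
  moreover have "\<forall>\<^sub>F n in sequentially. real n * \<epsilon> n powr p < 1" using lim by (rule order_tendstoD) simp
  ultimately have "\<forall>\<^sub>F n::nat in sequentially. False"
    using eventually_ge_at_top[of 1]
  proof eventually_elim
    case (elim n)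
    have e: "\<epsilon> n > 0" using pos elim by simp
    have "\<epsilon> n ^ d = \<epsilon> n powr real d" using e by (simp add: powr_realpow)
    also have "\<dots> \<le> \<epsilon> n powr p" using e elim pd by (intro powr_mono') auto
    finally have "real n * \<epsilon> n ^ d \<le> real n * \<epsilon> n powr p" by (intro mult_left_mono) auto
    moreover have "real n * \<epsilon> n ^ d \<ge> ln (real n)"
      using elim(1,2) pos_le_divide_eq[of "ln (real n)" 1 "real n * \<epsilon> n ^ d"] by simp
    ultimately show False using elim by linarith
  qed
  then show False by simp
qed

text \<open>Uncountably many centres are reduced to a net at half the radius: the half ball at a net
  point near \<open>u\<close> lies in the full ball at \<open>u\<close>. Only the random points
  beyond N are counted, and for n at least 2N they are at least half of the sample.\<close>

lemma AE_ball_counts: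
  fixes \<Omega> :: "'a::euclidean_space set" and x :: "nat \<Rightarrow> 'w \<Rightarrow> 'a" and \<epsilon> :: "nat \<Rightarrow> real"
  assumes M: "prob_space M" and ind: "prob_space.indep_vars M (\<lambda>_. borel) x {N<..}"
    and dist: "\<forall>i>N. distr M borel (x i) = \<mu>"
    and prob: "prob_space \<mu>" and sets: "sets \<mu> = sets borel" and c0: "c\<^sub>0 > 0"
    and lower: "\<And>u r. r > 0 \<Longrightarrow> ball u r \<subseteq> \<Omega> \<Longrightarrow> c\<^sub>0 * r ^ DIM('a) \<le> measure \<mu> (ball u r)"
    and pos: "\<forall>n\<ge>1. \<epsilon> n > 0" and s: "s > 0"
    and inf: "filterlim (\<lambda>n. real n * \<epsilon> n ^ DIM('a) / ln (real n)) at_top sequentially"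
  obtains c where "c > 0" "AE \<omega> in M. \<forall>\<^sub>F n in sequentially. \<forall>u. ball u (s * \<epsilon> n) \<subseteq> \<Omega> \<longrightarrow>
        c * real n * \<epsilon> n ^ DIM('a) \<le> real (card {i\<in>{1..n}. dist (x i \<omega>) u \<le> s * \<epsilon> n})"
proof -
  interpret prob_space M by (rule M)
  let ?d = "DIM('a)"
  \<comment> \<open>The 8 is 4 from the Chernoff threshold times 2 from keeping half of the sample.
    In \<open>c2\<close> the radius is halved twice: once for the net and once for its disjoint
    balls.\<close>
  define c1 where "c1 = c\<^sub>0 * (s / 2) ^ ?d / 8"
  define c2 where "c2 = 1 / (c\<^sub>0 * (s / 4) ^ ?d)"
  have c12: "c1 > 0" "c2 > 0" using c0 s by (auto simp: c1_def c2_def)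
  have rv: "x i \<in> borel_measurable M" if "i > N" for i
    using ind that by (auto simp: indep_vars_def)
  define net where "net n D \<longleftrightarrow> finite D \<and> real (card D) * (c\<^sub>0 * (s * \<epsilon> n / 2 / 2) ^ ?d) \<le> 1 \<and>
      (\<forall>q\<in>D. ball q (s * \<epsilon> n / 2) \<subseteq> \<Omega>) \<and> (\<forall>u. ball u (s * \<epsilon> n / 2) \<subseteq> \<Omega> \<longrightarrow> (\<exists>q\<in>D. dist u q < s * \<epsilon> n / 2))"
    for n and D :: "'a set"
  have "\<exists>D. net n D" if "n \<ge> 1" for n
  proof -
    have "s * \<epsilon> n / 2 > 0" using s pos that by simp
    from separated_net[OF prob sets c0 lower this] show ?thesis unfolding net_def by metis
  qed
  then obtain D where D: "\<And>n. n \<ge> 1 \<Longrightarrow> net n (D n)" by metis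
  define hits where "hits n q \<omega> = card {i\<in>{N<..n}. x i \<omega> \<in> ball q (s * \<epsilon> n / 2)}" for n q \<omega>
  define few where "few n q = {\<omega>\<in>space M. real (hits n q \<omega>)
       \<le> measure \<mu> (ball q (s * \<epsilon> n / 2)) * real (card {N<..n}) / 4}" for n q
  \<comment> \<open>The index 0 is set aside because positivity of \<open>\<epsilon> 0\<close> is
    not assumed and no net is available there.\<close>
  define bad where "bad n = (if n \<ge> 1 then \<Union>q\<in>D n. few n q else {})" for n
  have few_sets: "few n q \<in> events" for n q
  proof -
    have "real (hits n q \<omega>) = (\<Sum>i\<in>{N<..n}. indicator (ball q (s * \<epsilon> n / 2)) (x i \<omega>))" for \<omega>
      by (simp add: hits_def indicator_def sum.If_cases Int_def)
    then have [measurable]: "(\<lambda>\<omega>. real (hits n q \<omega>)) \<in> borel_measurable M"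
      by (simp, intro borel_measurable_sum measurable_compose[OF rv] borel_measurable_indicator) auto
    show ?thesis unfolding few_def by measurable
  qed
  have bad_sets: "bad n \<in> events" for n
    using D[of n] few_sets by (auto simp: bad_def net_def intro!: sets.finite_UN)
  have inf_ev: "\<forall>\<^sub>F n in sequentially. real n * \<epsilon> n ^ ?d / ln (real n) \<ge> K" for K
    using inf unfolding filterlim_at_top by blast
  have ln1: "\<forall>\<^sub>F n in sequentially. ln (real n) \<ge> 1" by real_asymp
  \<comment> \<open>The first bound makes each failure probability at most n^(-3), the second bounds
    the net by c2 n points; the union bound is then of order n^(-2), which is summable.\<close>
  have large: "\<forall>\<^sub>F n in sequentially. 3 * ln (real n) \<le> c1 * (real n * \<epsilon> n ^ ?d) \<and> 1 \<le> real n * \<epsilon> n ^ ?d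
        \<and> n \<ge> 1 \<and> n \<ge> 2 * N"
    using inf_ev[of "3 / c1"] inf_ev[of 1] ln1 eventually_ge_at_top[of 1] eventually_ge_at_top[of "2 * N"]
  proof eventually_elim
    case (elim n)
    have l: "ln (real n) > 0" using elim(3) by linarith
    have "3 / c1 * ln (real n) \<le> real n * \<epsilon> n ^ ?d" using elim(1) l by (metis pos_le_divide_eq)
    then have "3 * ln (real n) \<le> c1 * (real n * \<epsilon> n ^ ?d)" using c12 by (simp add: field_simps)
    moreover have "1 * ln (real n) \<le> real n * \<epsilon> n ^ ?d" using elim(2) l
      by (metis pos_le_divide_eq)
    then have "1 \<le> real n * \<epsilon> n ^ ?d" using elim(3) by linarith
    ultimately show ?case using elim by simp
  qed
  have expo: "c1 * (real n * \<epsilon> n ^ ?d) \<le> measure \<mu> (ball q (s * \<epsilon> n / 2)) * real (card {N<..n}) / 4"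
    if n: "n \<ge> 1" "n \<ge> 2 * N" and q: "ball q (s * \<epsilon> n / 2) \<subseteq> \<Omega>" for n q
  proof -
    have e: "\<epsilon> n > 0" using pos n by simp
    have "c1 * (real n * \<epsilon> n ^ ?d) = c\<^sub>0 * (s * \<epsilon> n / 2) ^ ?d * (real n / 2) / 4"
      by (simp add: c1_def power_mult_distrib power_divide mult_ac)
    also have "\<dots> \<le> measure \<mu> (ball q (s * \<epsilon> n / 2)) * real (card {N<..n}) / 4"
      using n q e s c0 by (intro divide_right_mono mult_mono lower) auto
    finally show ?thesis .
  qed
  have bad_prob: "prob (bad n) \<le> c2 * (1 / real n ^ 2)"
    if n: "3 * ln (real n) \<le> c1 * (real n * \<epsilon> n ^ ?d) \<and> 1 \<le> real n * \<epsilon> n ^ ?d \<and> n \<ge> 1 \<and> n \<ge> 2 * N" for n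
  proof -
    have e: "\<epsilon> n > 0" using pos n by simp
    have nD: "net n (D n)" using D n by blast
    have "prob (bad n) \<le> (\<Sum>q\<in>D n. prob (few n q))"
      using nD n few_sets unfolding bad_def by (auto simp: net_def intro!: finite_measure_subadditive_finite)
    also have "\<dots> \<le> (\<Sum>q\<in>D n. 1 / real n ^ 3)"
    proof (rule sum_mono)
      fix q assume "q \<in> D n"
      then have q: "ball q (s * \<epsilon> n / 2) \<subseteq> \<Omega>" using nD by (auto simp: net_def)
      have "prob (few n q) \<le> exp (- (measure \<mu> (ball q (s * \<epsilon> n / 2)) * real (card {N<..n}) / 4))"
        unfolding few_def hits_def
        using dist by (intro prob_few_hits indep_vars_subset[OF ind]) auto
      also have "\<dots> \<le> exp (- (3 * ln (real n)))"
        using expo[OF _ _ q] n by force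
      also have "\<dots> = 1 / real n ^ 3"
        using n by (simp add: exp_minus exp_of_nat_mult[of 3, simplified] divide_inverse)
      finally show "prob (few n q) \<le> 1 / real n ^ 3" .
    qed
    also have "\<dots> = real (card (D n)) * (1 / real n ^ 3)" by simp
    also have "\<dots> \<le> (c2 * real n) * (1 / real n ^ 3)"
    proof (rule mult_right_mono)
      have "real (card (D n)) * 1 \<le> real (card (D n)) * (real n * \<epsilon> n ^ ?d)"
        using n by (intro mult_left_mono) auto
      also have "\<dots> = real (card (D n)) * (c\<^sub>0 * (s * \<epsilon> n / 2 / 2) ^ ?d) * (c2 * real n)"
        using c0 s e by (simp add: c2_def power_mult_distrib power_divide)
      also have "\<dots> \<le> 1 * (c2 * real n)"
        using nD c12 by (intro mult_right_mono) (auto simp: net_def)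
      finally show "real (card (D n)) \<le> c2 * real n" by simp
    qed auto
    also have "\<dots> = c2 * (1 / real n ^ 2)"
      using n by (simp add: power2_eq_square power3_eq_cube)
    finally show ?thesis .
  qed
  have "summable (\<lambda>n. prob (bad n))"
  proof (rule summable_comparison_test_ev)
    show "\<forall>\<^sub>F n in sequentially. norm (prob (bad n)) \<le> c2 * (1 / real n ^ 2)"
      using large by eventually_elim (use bad_prob in auto)
    have "summable (\<lambda>n. inverse (real n ^ 2))" using inverse_power_summable[of 2] by simp
    then show "summable (\<lambda>n. c2 * (1 / real n ^ 2))"
      by (intro summable_mult) (simp add: divide_inverse)
  qed
  then have "AE \<omega> in M. \<forall>\<^sub>F n in sequentially. \<omega> \<in> space M - bad n"
    using bad_sets by (intro borel_cantelli_AE1) (auto simp: emeasure_eq_measure)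
  then have "AE \<omega> in M. \<forall>\<^sub>F n in sequentially. \<forall>u. ball u (s * \<epsilon> n) \<subseteq> \<Omega> \<longrightarrow>
        c1 * real n * \<epsilon> n ^ ?d \<le> real (card {i\<in>{1..n}. dist (x i \<omega>) u \<le> s * \<epsilon> n})"
  proof eventually_elim
    case (elim \<omega>)
    then show ?case using large
    proof eventually_elim
      case (elim n)
      have e: "\<epsilon> n > 0" using pos elim by simp
      have nD: "net n (D n)" using D elim by blast
      show ?case
      proof (intro allI impI)
        fix u assume u: "ball u (s * \<epsilon> n) \<subseteq> \<Omega>"
        have "ball u (s * \<epsilon> n / 2) \<subseteq> ball u (s * \<epsilon> n)" using e s by (intro subset_ball) auto
        then have "ball u (s * \<epsilon> n / 2) \<subseteq> \<Omega>" using u by blast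
        then obtain q where q: "q \<in> D n" "dist u q < s * \<epsilon> n / 2" using nD unfolding net_def by blast
        have qO: "ball q (s * \<epsilon> n / 2) \<subseteq> \<Omega>" using nD q by (auto simp: net_def)
        have "\<omega> \<notin> few n q" "\<omega> \<in> space M" using elim q by (auto simp: bad_def)
        then have "measure \<mu> (ball q (s * \<epsilon> n / 2)) * real (card {N<..n}) / 4 < real (hits n q \<omega>)"
          by (auto simp: few_def)
        moreover have "c1 * (real n * \<epsilon> n ^ ?d) \<le> measure \<mu> (ball q (s * \<epsilon> n / 2)) * real (card {N<..n}) / 4"
          using elim qO by (intro expo) auto
        moreover have "hits n q \<omega> \<le> card {i\<in>{1..n}. dist (x i \<omega>) u \<le> s * \<epsilon> n}"
          unfolding hits_def
        proof (rule card_mono)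
          show "{i \<in> {N<..n}. x i \<omega> \<in> ball q (s * \<epsilon> n / 2)} \<subseteq> {i \<in> {1..n}. dist (x i \<omega>) u \<le> s * \<epsilon> n}"
          proof safe
            fix i assume i: "i \<in> {N<..n}" "x i \<omega> \<in> ball q (s * \<epsilon> n / 2)"
            then show "i \<in> {1..n}" by auto
            show "dist (x i \<omega>) u \<le> s * \<epsilon> n"
              using i q dist_triangle[of "x i \<omega>" u q] by (auto simp: dist_commute)
          qed
        qed simp
        ultimately show "c1 * real n * \<epsilon> n ^ ?d \<le> real (card {i\<in>{1..n}. dist (x i \<omega>) u \<le> s * \<epsilon> n})"
          by (simp add: mult.assoc)
      qed
    qed
  qed
  then show ?thesis using that c12 by blast
qed

subsection \<open>Asymptotic equicontinuity and the limit\<close>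

lemma morrey_const_nonneg:
  assumes "real d < p" "d \<ge> 1"
  shows "morrey_const d p \<kappa> \<ge> 0"
proof -
  have "1 - real d / p > 0" using assms by simp
  then have "(1/2::real) powr (1 - real d / p) < 1"
    using powr_less_mono2[of "1 - real d / p" "1/2" 1] by simp
  then show ?thesis by (simp add: morrey_const_def)
qed

text \<open>With h = s \<epsilon> the kernel is at least b on all pairs within 3h, so the graph
  energy dominates the edge sum of \<open>point_cloud\<close>. The requirement that s be at most 1
  puts h below any fixed R for large n.\<close>

lemma graph_energy_imp_equicontinuous:
  fixes \<Omega> :: "'a::euclidean_space set" and X :: "nat \<Rightarrow> 'a" and \<epsilon> :: "nat \<Rightarrow> real"
  assumes p: "real DIM('a) < p"
    and pos: "\<forall>n\<ge>1. \<epsilon> n > 0" and eps0: "\<epsilon> \<longlonglongrightarrow> 0"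
    and lim: "(\<lambda>n. real n * \<epsilon> n powr p) \<longlonglongrightarrow> 0"
    and eta: "\<forall>t\<ge>0. \<eta> t \<ge> 0" and b: "b > 0" "\<And>t. 0 \<le> t \<Longrightarrow> t \<le> 3 * s \<Longrightarrow> b \<le> \<eta> t"
    and s: "s > 0" "s \<le> 1" and c: "c > 0"
    and counts: "\<forall>\<^sub>F n in sequentially. \<forall>u. ball u (s * \<epsilon> n) \<subseteq> \<Omega> \<longrightarrow>
        c * real n * \<epsilon> n ^ DIM('a) \<le> real (card {i\<in>{1..n}. dist (X i) u \<le> s * \<epsilon> n})"
    and energy: "bdd_above ((\<lambda>n. graph_energy p \<eta> \<epsilon> X n (\<phi> n)) ` {1..})"
  obtains C where "C \<ge> 0" "\<And>R e. R > 0 \<Longrightarrow> e > 0 \<Longrightarrow> \<forall>\<^sub>F n in sequentially. \<forall>i\<in>{1..n}. \<forall>j\<in>{1..n}.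
        dist (X i) (X j) \<le> R \<longrightarrow> ball (X i) (4 * R) \<subseteq> \<Omega> \<longrightarrow>
        \<bar>\<phi> n (X i) - \<phi> n (X j)\<bar> \<le> C * R powr (1 - real DIM('a) / p) + e"
proof -
  let ?d = "DIM('a)"
  have p0: "p > 0" using p by linarith
  obtain E where E: "E > 0" "\<And>n. n \<ge> 1 \<Longrightarrow> graph_energy p \<eta> \<epsilon> X n (\<phi> n) \<le> E"
  proof -
    obtain E' where "\<And>n. n \<ge> 1 \<Longrightarrow> graph_energy p \<eta> \<epsilon> X n (\<phi> n) \<le> E'"
      using energy by (auto simp: bdd_above_def)
    then show thesis by (intro that[of "max E' 1"]) (auto simp: le_max_iff_disj)
  qed
  \<comment> \<open>The energy bound gives an edge sum of at most E n^2 \<epsilon>^(p+d) / b. Both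
    sides carry the same powers of n and \<epsilon>, so \<kappa> does not depend on n.\<close>
  define \<kappa> where "\<kappa> = E / (b * s powr (p - real ?d) * c\<^sup>2)"
  have \<kappa>: "\<kappa> > 0" using E b s c by (simp add: \<kappa>_def)
  define C where "C = 4 * morrey_const ?d p \<kappa>"
  have C: "C \<ge> 0" using morrey_const_nonneg[OF p] DIM_positive[where 'a='a] by (simp add: C_def Suc_leI)
  define err where "err n = 2 * (\<kappa> * (s powr (p - real ?d) * c * (real n * \<epsilon> n powr p))) powr (1 / p)" for n
  have "err \<longlonglongrightarrow> 2 * (\<kappa> * (s powr (p - real ?d) * c * 0)) powr (1 / p)"
    unfolding err_def using lim p0 \<kappa> c by (intro tendsto_intros) auto
  then have err0: "err \<longlonglongrightarrow> 0" by simp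
  have small: "(\<Sum>i=1..n. \<Sum>j=1..n. if dist (X i) (X j) \<le> 3 * (s * \<epsilon> n) then \<bar>\<phi> n (X i) - \<phi> n (X j)\<bar> powr p else 0)
      \<le> \<kappa> * (s * \<epsilon> n) powr (p - real ?d) * (c * real n * \<epsilon> n ^ ?d)\<^sup>2" if n: "n \<ge> 1" for n
  proof -
    have e: "\<epsilon> n > 0" using pos n by simp
    let ?T = "\<Sum>i=1..n. \<Sum>j=1..n. if dist (X i) (X j) \<le> 3 * (s * \<epsilon> n) then \<bar>\<phi> n (X i) - \<phi> n (X j)\<bar> powr p else 0"
    have "b / \<epsilon> n ^ ?d * ?T
       \<le> (\<Sum>i=1..n. \<Sum>j=1..n. rescaled_kernel ?d \<eta> (\<epsilon> n) (norm (X i - X j)) * \<bar>\<phi> n (X i) - \<phi> n (X j)\<bar> powr p)"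
      unfolding sum_distrib_left
    proof (intro sum_mono)
      fix i j
      show "b / \<epsilon> n ^ ?d * (if dist (X i) (X j) \<le> 3 * (s * \<epsilon> n) then \<bar>\<phi> n (X i) - \<phi> n (X j)\<bar> powr p else 0)
         \<le> rescaled_kernel ?d \<eta> (\<epsilon> n) (norm (X i - X j)) * \<bar>\<phi> n (X i) - \<phi> n (X j)\<bar> powr p"
      proof (cases "dist (X i) (X j) \<le> 3 * (s * \<epsilon> n)")
        case True
        then have "norm (X i - X j) / \<epsilon> n \<le> 3 * s" using e by (simp add: dist_norm field_simps)
        then have "b \<le> \<eta> (norm (X i - X j) / \<epsilon> n)" using e by (intro b) auto
        then show ?thesis using True e by (auto simp: rescaled_kernel_def intro!: mult_right_mono divide_right_mono)
      next
        case False
        then show ?thesis using eta e by (simp add: rescaled_kernel_def)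
      qed
    qed
    also have "\<dots> = \<epsilon> n powr p * (real n)\<^sup>2 * graph_energy p \<eta> \<epsilon> X n (\<phi> n)"
      using e n by (simp add: graph_energy_def)
    also have "\<dots> \<le> \<epsilon> n powr p * (real n)\<^sup>2 * E"
      using E(2)[OF n] by (intro mult_left_mono) auto
    finally have "?T \<le> \<epsilon> n powr p * (real n)\<^sup>2 * E * (\<epsilon> n ^ ?d / b)"
      using b e by (simp add: field_simps)
    also have "\<epsilon> n powr p = \<epsilon> n powr (p - real ?d) * \<epsilon> n ^ ?d"
      using e by (simp add: powr_realpow[symmetric] powr_add[symmetric])
    also have "\<epsilon> n powr (p - real ?d) * \<epsilon> n ^ ?d * (real n)\<^sup>2 * E * (\<epsilon> n ^ ?d / b)
        = \<kappa> * (s * \<epsilon> n) powr (p - real ?d) * (c * real n * \<epsilon> n ^ ?d)\<^sup>2"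
      using b s c e by (simp add: \<kappa>_def powr_mult power2_eq_square)
    finally show ?thesis .
  qed
  show thesis
  proof (rule that[OF C])
    fix R e :: real assume R: "R > 0" and e: "e > 0"
    have "\<forall>\<^sub>F n in sequentially. err n < e" using err0 e by (rule order_tendstoD)
    moreover have "\<forall>\<^sub>F n in sequentially. \<epsilon> n < R" using eps0 R by (rule order_tendstoD)
    ultimately show "\<forall>\<^sub>F n in sequentially. \<forall>i\<in>{1..n}. \<forall>j\<in>{1..n}.
        dist (X i) (X j) \<le> R \<longrightarrow> ball (X i) (4 * R) \<subseteq> \<Omega> \<longrightarrow>
        \<bar>\<phi> n (X i) - \<phi> n (X j)\<bar> \<le> C * R powr (1 - real ?d / p) + e"
      using counts eventually_ge_at_top[of 1]
    proof eventually_elim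
      case (elim n)
      have eps: "\<epsilon> n > 0" using pos elim by simp
      define h where "h = s * \<epsilon> n"
      have hR: "h > 0" "h \<le> R"
      proof -
        have "s * \<epsilon> n \<le> 1 * \<epsilon> n" using s eps by (intro mult_right_mono) auto
        then show "h \<le> R" using elim by (simp add: h_def)
      qed (use s eps in \<open>simp add: h_def\<close>)
      interpret point_cloud "{1..n}" X "\<lambda>i. \<phi> n (X i)" h p "c * real n * \<epsilon> n ^ ?d" \<kappa> "{u. ball u h \<subseteq> \<Omega>}"
      proof
        show "c * real n * \<epsilon> n ^ ?d > 0" using c eps elim by simp
        show "c * real n * \<epsilon> n ^ ?d \<le> real (card {i\<in>{1..n}. dist (X i) u \<le> h})" if "u \<in> {u. ball u h \<subseteq> \<Omega>}" for u
          using elim that by (simp add: h_def)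
        show "(\<Sum>i=1..n. \<Sum>j=1..n. if dist (X i) (X j) \<le> 3 * h then \<bar>\<phi> n (X i) - \<phi> n (X j)\<bar> powr p else 0)
            \<le> \<kappa> * h powr (p - real ?d) * (c * real n * \<epsilon> n ^ ?d)\<^sup>2"
          using small[of n] elim by (simp add: h_def)
      qed (use hR p \<kappa> in auto)
      show ?case
      proof (intro ballI impI)
        fix i j assume ij: "i \<in> {1..n}" "j \<in> {1..n}" and d: "dist (X i) (X j) \<le> R"
          and sub: "ball (X i) (4 * R) \<subseteq> \<Omega>"
        \<comment> \<open>Centres within 2R have h-balls within 2R + h, at most 3R, so the radius 4R
          leaves room.\<close>
        have "ball (X i) (2 * R) \<subseteq> {u. ball u h \<subseteq> \<Omega>}"
        proof safe
          fix u v assume "u \<in> ball (X i) (2 * R)" "v \<in> ball u h"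
          then have "dist (X i) u < 2 * R" "dist u v < h" by auto
          then have "v \<in> ball (X i) (4 * R)"
            using hR(2) R dist_triangle[of "X i" v u] unfolding mem_ball by linarith
          then show "v \<in> \<Omega>" using sub by blast
        qed
        then have "\<bar>\<phi> n (X i) - \<phi> n (X j)\<bar> \<le> 4 * morrey_const ?d p \<kappa> * R powr (1 - real ?d / p)
           + 2 * (\<kappa> * h powr (p - real ?d) * (c * real n * \<epsilon> n ^ ?d)) powr (1 / p)"
          using ij d hR by (intro phi_holder) auto
        also have "\<kappa> * h powr (p - real ?d) * (c * real n * \<epsilon> n ^ ?d)
            = \<kappa> * (s powr (p - real ?d) * c * (real n * (\<epsilon> n powr (p - real ?d) * \<epsilon> n ^ ?d)))"
          using s eps by (simp add: h_def powr_mult)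
        also have "\<epsilon> n powr (p - real ?d) * \<epsilon> n ^ ?d = \<epsilon> n powr p"
          using eps by (simp add: powr_realpow[symmetric] powr_add[symmetric])
        finally show "\<bar>\<phi> n (X i) - \<phi> n (X j)\<bar> \<le> C * R powr (1 - real ?d / p) + e"
          using elim(1) by (simp add: C_def err_def)
      qed
    qed
  qed
qed

text \<open>The continuous representative \<open>g\<close> may depend on the realisation, as
  \<open>f\<close> does. The interpolation condition starts at n = k because the k-th point belongs
  to the sample only from then on.\<close>

theorem lemma4p5:
  fixes \<Omega> :: "'a::euclidean_space set"
    and \<rho> :: "'a \<Rightarrow> real"
    and \<mu> :: "'a measure"
    and M :: "'w measure"
    and N :: nat
    and a :: "nat \<Rightarrow> 'a"
    and y :: "nat \<Rightarrow> real"
    and x :: "nat \<Rightarrow> 'w \<Rightarrow> 'a"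
    and \<epsilon> :: "nat \<Rightarrow> real"
    and \<eta> :: "real \<Rightarrow> real"
    and e\<^sub>1 :: 'a
    and p :: real
    and fn :: "nat \<Rightarrow> 'w \<Rightarrow> 'a \<Rightarrow> real"
    and f :: "'w \<Rightarrow> 'a \<Rightarrow> real"
  assumes "p > 1"
    and "open \<Omega>" and "connected \<Omega>" and "bounded \<Omega>" and "lipschitz_boundary \<Omega>"
    and "continuous_on \<Omega> \<rho>"
    and "\<exists>c C. 0 < c \<and> 0 < C \<and> (\<forall>z\<in>\<Omega>. c \<le> \<rho> z \<and> \<rho> z \<le> C)"
    and "\<mu> = density lborel (\<lambda>z. ennreal (indicator \<Omega> z * \<rho> z))"
    and "prob_space \<mu>"
    and "N \<ge> 1" and "a ` {1..N} \<subseteq> \<Omega>" and "inj_on a {1..N}"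
    and "prob_space M"
    and "\<forall>k\<in>{1..N}. \<forall>\<omega>\<in>space M. x k \<omega> = a k"
    and "prob_space.indep_vars M (\<lambda>_. borel) x {N<..}"
    and "\<forall>i>N. distr M borel (x i) = \<mu>"
    and "\<forall>n\<ge>1. \<epsilon> n > 0"
    and "\<epsilon> \<longlonglongrightarrow> 0"
    and "filterlim (\<lambda>n. \<epsilon> n / length_scale DIM('a) n) at_top sequentially"
    and "\<forall>t\<ge>0. \<eta> t \<ge> 0"
    and "monotone_on {0..} (\<le>) (\<ge>) \<eta>"
    and "\<eta> 0 > 0" and "continuous (at 0 within {0..}) \<eta>"
    and "e\<^sub>1 \<in> Basis" and "sigma_eta e\<^sub>1 p \<eta> < \<top>"
    and "(\<lambda>n. real n * \<epsilon> n powr p) \<longlonglongrightarrow> 0"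
    and "AE \<omega> in M. tlp_converges p \<Omega>
           (\<lambda>n. (empirical_measure (\<lambda>i. x i \<omega>) n,
                 extend_by_zero (sample_points (\<lambda>i. x i \<omega>) n) (fn n \<omega>)))
           (\<mu>, f \<omega>)"
    and "AE \<omega> in M. bdd_above ((\<lambda>n. graph_energy p \<eta> \<epsilon> (\<lambda>i. x i \<omega>) n (fn n \<omega>)) ` {1..})"
  shows "1 - real DIM('a) / p > 0 \<and>
    (AE \<omega> in M. \<exists>g.
        continuous_on \<Omega> g \<and> (AE z in \<mu>. f \<omega> z = g z) \<and>
        g \<in> holder_space (1 - real DIM('a) / p) \<Omega> \<and>
        (\<forall>\<Omega>'. compactly_contained \<Omega>' \<Omega> \<longrightarrow>
           (\<lambda>n. max_deviation (\<lambda>i. x i \<omega>) n \<Omega>' g (fn n \<omega>)) \<longlonglongrightarrow> 0) \<and>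
        ((\<forall>k\<in>{1..N}. \<forall>n\<ge>k. fn n \<omega> (x k \<omega>) = y k) \<longrightarrow> (\<forall>k\<in>{1..N}. g (x k \<omega>) = y k)))"
proof -
  let ?d = "DIM('a)"
  note p1 = assms(1) and op = assms(2) and bd = assms(4) and lip = assms(5) and cont = assms(6)
    and \<mu> = assms(8) and prob = assms(9) and a\<Omega> = assms(11) and M = assms(13) and xa = assms(14)
    and ind = assms(15) and dist = assms(16) and pos = assms(17) and eps0 = assms(18)
    and scale = assms(19) and eta = assms(20) and lim = assms(26) and tlp = assms(27) and energy = assms(28)
  obtain c\<^sub>1 where c\<^sub>1: "c\<^sub>1 > 0" "\<And>z. z \<in> \<Omega> \<Longrightarrow> c\<^sub>1 \<le> \<rho> z" using assms(7) by blast
  have m\<rho>: "(\<lambda>z. ennreal (indicator \<Omega> z * \<rho> z)) \<in> borel_measurable lborel"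
    using borel_measurable_continuous_on_indicator[OF _ cont] op by simp
  have sets: "sets \<mu> = sets borel" by (simp add: \<mu>)
  interpret \<mu>: prob_space \<mu> by (rule prob)
  have AE_\<Omega>: "AE z in \<mu>. z \<in> \<Omega>"
    unfolding \<mu> by (subst AE_density[OF m\<rho>]) (auto simp: indicator_def)
  define c\<^sub>0 where "c\<^sub>0 = c\<^sub>1 * unit_ball_vol (real ?d)"
  have c\<^sub>0: "c\<^sub>0 > 0" using c\<^sub>1 by (simp add: c\<^sub>0_def)
  have lower: "c\<^sub>0 * r ^ ?d \<le> measure \<mu> (ball u r)" if r: "r > 0" "ball u r \<subseteq> \<Omega>" for u r
  proof -
    have "ennreal (c\<^sub>0 * r ^ ?d) = ennreal c\<^sub>1 * emeasure lborel (ball u r)"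
      using r c\<^sub>1 by (simp add: emeasure_ball c\<^sub>0_def ennreal_mult' mult.assoc)
    also have "\<dots> = (\<integral>\<^sup>+z. ennreal c\<^sub>1 * indicator (ball u r) z \<partial>lborel)"
      by (simp add: nn_integral_cmult_indicator)
    also have "\<dots> \<le> (\<integral>\<^sup>+z. ennreal (indicator \<Omega> z * \<rho> z) * indicator (ball u r) z \<partial>lborel)"
      using r c\<^sub>1 by (intro nn_integral_mono) (auto simp: indicator_def intro!: ennreal_leI)
    also have "\<dots> = emeasure \<mu> (ball u r)"
      unfolding \<mu> by (subst emeasure_density[OF m\<rho>]) auto
    finally show ?thesis by (simp add: \<mu>.emeasure_eq_measure)
  qed
  \<comment> \<open>Continuity at 0 keeps \<eta> above half its value at 0 on [0, \<delta>). The
    factor 1/6 puts the required range 3 s within \<delta>/2.\<close>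
  obtain b s where b: "b > 0" "\<And>t. 0 \<le> t \<Longrightarrow> t \<le> 3 * s \<Longrightarrow> b \<le> \<eta> t" and s: "s > 0" "s \<le> 1"
  proof -
    have "(\<eta> \<longlongrightarrow> \<eta> 0) (at 0 within {0..})" using assms(23) by (simp add: continuous_within)
    then have "\<forall>\<^sub>F t in at 0 within {0..}. \<eta> t > \<eta> 0 / 2"
      using assms(22) by (intro order_tendstoD(1)) auto
    then obtain \<delta> where \<delta>: "\<delta> > 0" "\<And>t. t \<ge> 0 \<Longrightarrow> t \<noteq> 0 \<Longrightarrow> \<bar>t\<bar> < \<delta> \<Longrightarrow> \<eta> t > \<eta> 0 / 2"
      by (auto simp: eventually_at dist_real_def)
    show thesis
    proof (rule that[of "\<eta> 0 / 2" "min 1 (\<delta> / 6)"])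
      fix t :: real assume t: "0 \<le> t" "t \<le> 3 * min 1 (\<delta> / 6)"
      then have "t < \<delta>" using \<delta>(1) by linarith
      then show "\<eta> 0 / 2 \<le> \<eta> t" using \<delta>(2)[of t] t assms(22) by (cases "t = 0") auto
    qed (use \<delta> assms(22) in auto)
  qed
  have inf: "filterlim (\<lambda>n. real n * \<epsilon> n ^ ?d / ln (real n)) at_top sequentially"
    using scale by (rule length_scale_imp_dense_sample) (simp add: Suc_leI)
  have dp: "real ?d < p" by (rule dim_less_exponent[OF inf pos eps0 lim])
  define \<gamma> where "\<gamma> = 1 - real ?d / p"
  have \<gamma>: "\<gamma> > 0" using dp p1 by (simp add: \<gamma>_def)
  obtain c where c: "c > 0" and counts: "AE \<omega> in M. \<forall>\<^sub>F n in sequentially. \<forall>u. ball u (s * \<epsilon> n) \<subseteq> \<Omega> \<longrightarrow>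
        c * real n * \<epsilon> n ^ ?d \<le> real (card {i\<in>{1..n}. dist (x i \<omega>) u \<le> s * \<epsilon> n})"
    using AE_ball_counts[OF M ind dist prob sets c\<^sub>0 lower pos s(1) inf] by blast
  have "AE \<omega> in M. \<exists>g.
        continuous_on \<Omega> g \<and> (AE z in \<mu>. f \<omega> z = g z) \<and>
        g \<in> holder_space \<gamma> \<Omega> \<and>
        (\<forall>\<Omega>'. compactly_contained \<Omega>' \<Omega> \<longrightarrow>
           (\<lambda>n. max_deviation (\<lambda>i. x i \<omega>) n \<Omega>' g (fn n \<omega>)) \<longlonglongrightarrow> 0) \<and>
        ((\<forall>k\<in>{1..N}. \<forall>n\<ge>k. fn n \<omega> (x k \<omega>) = y k) \<longrightarrow> (\<forall>k\<in>{1..N}. g (x k \<omega>) = y k))"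
    using counts tlp energy AE_space
  proof eventually_elim
    case (elim \<omega>)
    obtain C where C: "C \<ge> 0" "\<And>R e. R > 0 \<Longrightarrow> e > 0 \<Longrightarrow> \<forall>\<^sub>F n in sequentially. \<forall>i\<in>{1..n}. \<forall>j\<in>{1..n}.
        dist (x i \<omega>) (x j \<omega>) \<le> R \<longrightarrow> ball (x i \<omega>) (4 * R) \<subseteq> \<Omega> \<longrightarrow>
        \<bar>fn n \<omega> (x i \<omega>) - fn n \<omega> (x j \<omega>)\<bar> \<le> C * R powr \<gamma> + e"
      using graph_energy_imp_equicontinuous[OF dp pos eps0 lim eta b s c elim(1) elim(3)]
      unfolding \<gamma>_def by blast
    interpret sample_limit \<Omega> \<mu> "\<lambda>i. x i \<omega>" "\<lambda>n. fn n \<omega>" "f \<omega>" p \<gamma> c\<^sub>0 C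
    proof
      show "f \<omega> \<in> borel_measurable borel"
        using elim(2) measurable_cong_sets[OF sets refl] by (auto simp: tlp_converges_def TLp_def)
    qed (use op prob sets AE_\<Omega> c\<^sub>0 lower elim(2) p1 \<gamma> C in auto)
    obtain g where g: "continuous_on \<Omega> g" "AE z in \<mu>. f \<omega> z = g z" "g \<in> holder_space \<gamma> \<Omega>"
      and dev: "\<And>\<Omega>'. compactly_contained \<Omega>' \<Omega> \<Longrightarrow>
         (\<lambda>n. max_deviation (\<lambda>i. x i \<omega>) n \<Omega>' g (fn n \<omega>)) \<longlonglongrightarrow> 0"
      using limit_holder_and_uniform[OF bd lip] by blast
    have "g (x k \<omega>) = y k" if k: "k \<in> {1..N}" and fit: "\<forall>k\<in>{1..N}. \<forall>n\<ge>k. fn n \<omega> (x k \<omega>) = y k" for k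
    proof -
      have "x k \<omega> \<in> \<Omega>" using xa k a\<Omega> elim(4) by auto
      \<comment> \<open>A labelled point forms a compactly contained singleton, so uniform
        convergence on it is convergence at the point, where the discrete value is constantly
        \<open>y k\<close>.\<close>
      then have lim0: "(\<lambda>n. max_deviation (\<lambda>i. x i \<omega>) n {x k \<omega>} g (fn n \<omega>)) \<longlonglongrightarrow> 0"
        by (intro dev) (simp add: compactly_contained_def)
      have "\<forall>\<^sub>F n in sequentially. \<bar>g (x k \<omega>) - y k\<bar> \<le> max_deviation (\<lambda>i. x i \<omega>) n {x k \<omega>} g (fn n \<omega>)"
        using eventually_ge_at_top[of k]
      proof eventually_elim
        case (elim n)
        then have "fn n \<omega> (x k \<omega>) = y k" using fit k by blast
        then show ?case
          unfolding max_deviation_def using k elim by (intro Max_ge) (auto intro!: image_eqI[of _ _ k])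
      qed
      then have "\<bar>g (x k \<omega>) - y k\<bar> \<le> 0" by (rule tendsto_lowerbound[OF lim0]) simp
      then show ?thesis by simp
    qed
    then show ?case using g dev by blast
  qed
  then show ?thesis using \<gamma> unfolding \<gamma>_def by blast
qed

end
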